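(* Let $0\le k\le n$ be integers with $n\ge 1$. The map $\Phi$ is a bijection from the set of permutation tableaux contained in a $k\times(n-k)$ rectangle to the set of permutations in the symmetric group $\mathcal{S}_n$ with exactly $k$ weak excedances. Consequently, letting $k$ vary, $\Phi$ is a bijection from permutation tableaux (contained in a $k\times(n-k)$ rectangle for some $k$) to permutations in $\mathcal{S}_n$.
   Context: **Permutation tableaux.** A permutation tableau contained in a $k\times(n-k)$ rectangle is a partition $\lambda=(\lambda_1\ge\dots\ge\lambda_k\ge 0)$ with $\lambda_1\le n-k$, whose Young diagram $Y_\lambda$ (left-justified, $\lambda_i$ boxes in the $i$-th row from the top) is placed in the rectangle with its top row at the top and its left edge at the left side of the rectangle, together with a filling of the boxes of $Y_\lambda$ by $0$'s and $1$'s such that: (1) each of the $n-k$ columns of the rectangle contains at least one $1$; (2) there is no $0$ which has a $1$ above it in the same column and a $1$ to its left in the same row. Rows of length $0$ are allowed. **Partition path.** The southeast border of $Y_\lambda$ gives a lattice path $P$ of $n$ unit steps from the northeast corner to the southwest corner of the rectangle; its steps are labeled $1,\dots,n$ in the order taken. Vertical steps correspond to rows (right end of the row), horizontal steps to columns (bottom of the column). **Diagram.** Remove the $0$'s and replace each $1$ by a vertex. From each vertex draw an edge east to the next vertex in its row, or, if there is none, to the label of the vertical step at the right end of the row; and an edge south to the next vertex in its column, or, if there is none, to the label of the horizontal step at the bottom of the column. **The map $\Phi$.** Given a permutation tableau $\mathcal{T}$, define $\pi=\Phi(\mathcal{T})$ as follows. If $i$ labels a vertical step: if the row of $i$ has no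 vertices, set $\pi(i)=i$; otherwise travel from label $i$ west as far as possible (to the leftmost vertex of the row), then follow edges south and east, starting with south and turning at every new vertex encountered, until a label $j$ is reached; set $\pi(i)=j$. If $i$ labels a horizontal step: travel from label $i$ north as far as possible (to the topmost vertex of the column), then follow edges east and south, starting with east and turning at every new vertex encountered, until a label $j$ is reached; set $\pi(i)=j$. A weak excedance of a permutation $\pi\in\mathcal{S}_n$ is a value $\pi(i)$ with $\pi(i)\ge i$; the number of weak excedances is the number of such $i$. *)

theory Defs
  imports "HOL-Library.FuncSet" "HOL-Combinatorics.Permutations"
begin

text \<open>
  Rows and columns are counted from 0; the box \<open>(r, c)\<close> lies in row \<open>r\<close> (from the top) and
  column \<open>c\<close> (from the left). The field \<open>shape\<close> lists all row lengths of the partition, zeros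
  included, so the ambient rectangle has \<open>length (shape T)\<close> rows and \<open>width T\<close> columns.
\<close>

record tableau =
  shape :: "nat list"
  width :: nat
  entry :: "nat \<times> nat \<Rightarrow> nat"

definition young_diagram :: "nat list \<Rightarrow> (nat \<times> nat) set" where
  "young_diagram l = {(r, c). r < length l \<and> c < l ! r}"

text \<open>
  The filling is required to be an extensional function on the boxes (\<open>\<rightarrow>\<^sub>E\<close>), so that equality
  of records is equality of tableaux.
\<close>

definition permutation_tableaux :: "nat \<Rightarrow> nat \<Rightarrow> tableau set" where
  "permutation_tableaux k m = {T.
     length (shape T) = k \<and> width T = m \<and>
     sorted_wrt (\<ge>) (shape T) \<and> (\<forall>x \<in> set (shape T). x \<le> m) \<and>
     entry T \<in> young_diagram (shape T) \<rightarrow>\<^sub>E {0, 1} \<and>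
     (\<forall>c < m. \<exists>r. (r, c) \<in> young_diagram (shape T) \<and> entry T (r, c) = 1) \<and>
     \<not> (\<exists>r c. (r, c) \<in> young_diagram (shape T) \<and> entry T (r, c) = 0 \<and>
          (\<exists>r' < r. entry T (r', c) = 1) \<and> (\<exists>c' < c. entry T (r, c') = 1))}"

text \<open>
  \<open>Vertical r\<close> is the step at the right end of row \<open>r\<close>, \<open>Horizontal c\<close> the step at the bottom
  of column \<open>c\<close>. In \<open>border r c ls\<close> the path stands at the left of column \<open>c\<close> (equivalently, at
  horizontal distance \<open>c\<close> from the left side), above row \<open>r\<close>, and \<open>ls\<close> are the lengths of the
  rows from \<open>r\<close> on.
\<close>

datatype step = Vertical nat | Horizontal nat

fun border :: "nat \<Rightarrow> nat \<Rightarrow> nat list \<Rightarrow> step list" where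
  "border r c [] = map Horizontal (rev [0..<c])"
| "border r c (l # ls) =
     map Horizontal (rev [l..<c]) @ Vertical r # border (Suc r) l ls"

definition partition_path :: "tableau \<Rightarrow> step list" where
  "partition_path T = border 0 (width T) (shape T)"

definition label_of :: "tableau \<Rightarrow> step \<Rightarrow> nat" where
  "label_of T s =
     (THE i. i \<in> {1..length (partition_path T)} \<and> partition_path T ! (i - 1) = s)"

definition vertices :: "tableau \<Rightarrow> (nat \<times> nat) set" where
  "vertices T = {b \<in> young_diagram (shape T). entry T b = 1}"

datatype node = Vertex "nat \<times> nat" | Label nat

datatype direction = East | South

fun turn :: "direction \<Rightarrow> direction" where
  "turn East = South"
| "turn South = East"

fun edge :: "tableau \<Rightarrow> direction \<Rightarrow> nat \<times> nat \<Rightarrow> node" where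
  "edge T East (r, c) =
     (if \<exists>c' > c. (r, c') \<in> vertices T
      then Vertex (r, LEAST c'. c' > c \<and> (r, c') \<in> vertices T)
      else Label (label_of T (Vertical r)))"
| "edge T South (r, c) =
     (if \<exists>r' > r. (r', c) \<in> vertices T
      then Vertex (LEAST r'. r' > r \<and> (r', c) \<in> vertices T, c)
      else Label (label_of T (Horizontal c)))"

text \<open>
  The label reached when leaving vertex \<open>v\<close> in direction \<open>d\<close> and turning at every new vertex.
  Since edges lead strictly south or east inside a finite diagram, the recursion stops.
\<close>

partial_function (tailrec) travel :: "tableau \<Rightarrow> direction \<Rightarrow> nat \<times> nat \<Rightarrow> nat" where
  "travel T d v =
     (case edge T d v of Label j \<Rightarrow> j | Vertex w \<Rightarrow> travel T (turn d) w)"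

text \<open>
  Outside the labels \<open>\<Phi> T\<close> is the identity, as the library's \<^const>\<open>permutes\<close> demands.
\<close>

definition \<Phi> :: "tableau \<Rightarrow> nat \<Rightarrow> nat" where
  "\<Phi> T i =
     (if i \<in> {1..length (partition_path T)} then
        (case partition_path T ! (i - 1) of
           Vertical r \<Rightarrow>
             (if \<exists>c. (r, c) \<in> vertices T
              then travel T South (r, LEAST c. (r, c) \<in> vertices T)
              else i)
         | Horizontal c \<Rightarrow> travel T East (LEAST r. (r, c) \<in> vertices T, c))
      else i)"

definition weak_excedances :: "nat \<Rightarrow> (nat \<Rightarrow> nat) \<Rightarrow> nat set" where
  "weak_excedances n p = {i \<in> {1..n}. p i \<ge> i}"

end

theory Submission
  imports Defs
begin

text \<open>
  Read every box as a tile, a \<open>1\<close> being a bounce and a \<open>0\<close> a crossing; then \<open>\<Phi> T\<close> follows the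
  wires from the northwest to the southeast border. Remove the last step of the border. If it is
  vertical, the bottom row is empty and \<open>\<Phi>\<close> gains the fixed point \<open>n\<close>. If it is horizontal, the
  leftmost column has full height; its ones may be placed in any nonempty set of unrestricted rows
  (rows without a \<open>0\<close> that has a \<open>1\<close> above it). With \<open>l\<^sub>1 < \<dots> < l\<^sub>s\<close> the labels of these rows, the
  column composes \<open>\<Phi>\<close> with the cycle \<open>n \<mapsto> l\<^sub>1 \<mapsto> \<dots> \<mapsto> l\<^sub>s \<mapsto> n\<close>.

  By induction, the labels of the unrestricted rows are the left-to-right maxima of \<open>\<Phi> T\<close>. Hence
  the set of the \<open>l\<^sub>i\<close> can be read off \<open>q = \<Phi> T\<close>, as the left-to-right maxima whose value exceeds
  \<open>q n\<close>, and the step can be undone on permutations. As a left-to-right maximum is a weak excedance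
  and \<open>q\<close> only grows on the \<open>l\<^sub>i\<close>, the weak excedances remain the labels of the rows.
\<close>

section \<open>Left-to-right maxima of permutations\<close>

definition lr_maxima :: "nat \<Rightarrow> (nat \<Rightarrow> nat) \<Rightarrow> nat set" where
  "lr_maxima n p = {i \<in> {1..n}. \<forall>j \<in> {1..<i}. p j < p i}"

text \<open>
  The cycle \<open>N \<mapsto> Min L \<mapsto> \<dots> \<mapsto> Max L \<mapsto> N\<close> through \<open>L\<close> in increasing order, for \<open>N\<close> above \<open>L\<close>.
\<close>

definition insertion_cycle :: "nat \<Rightarrow> nat set \<Rightarrow> nat \<Rightarrow> nat" where
  "insertion_cycle N L i =
     (if i = N then Min L else if i \<in> L then (LEAST j. j \<in> insert N L \<and> i < j) else i)"

lemma lr_maxima_less: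
  assumes "i \<in> lr_maxima n p" "j \<in> {1..<i}"
  shows "p j < p i"
  using assms by (auto simp: lr_maxima_def)

text \<open>Pigeonhole: \<open>p\<close> takes \<open>i\<close> distinct positive values on
  \<open>{1..i}\<close>, and none of them exceeds \<open>p i\<close>.\<close>

lemma lr_maxima_ge:
  assumes p: "p permutes {1..n}" and i: "i \<in> lr_maxima n p"
  shows "i \<le> p i"
proof -
  have sub: "p ` {1..i} \<subseteq> {1..p i}"
  proof
    fix x assume "x \<in> p ` {1..i}"
    then obtain j where j: "j \<in> {1..i}" "x = p j" by blast
    have "j \<in> {1..n}" using j i by (auto simp: lr_maxima_def)
    then have "p j \<in> {1..n}" using permutes_in_image[OF p] by blast
    moreover have "p j \<le> p i"
      using j lr_maxima_less[OF i, of j] by (cases "j = i") auto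
    ultimately show "x \<in> {1..p i}" using j by auto
  qed
  have "card (p ` {1..i}) = i"
    using permutes_inj[OF p] by (simp add: card_image inj_on_def inj_def)
  then show ?thesis using card_mono[OF _ sub] by simp
qed

text \<open>The permutation side of adding an empty row: \<open>p\<close> fixes
  \<open>Suc n\<close>, and this value exceeds all earlier ones.\<close>

lemma lr_maxima_Suc_fixed:
  assumes p: "p permutes {1..n}"
  shows "lr_maxima (Suc n) p = insert (Suc n) (lr_maxima n p)"
proof -
  have "p (Suc n) = Suc n" using permutes_not_in[OF p] by simp
  moreover have "p j < Suc n" if "j \<in> {1..n}" for j
    using permutes_in_image[OF p, of j] that by simp
  ultimately show ?thesis
    by (auto simp: lr_maxima_def le_Suc_eq)
qed

text \<open>Descent: a position that is not a left-to-right maximum has an earlier one with at least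
  the same value. Used to bound values at positions off the cycle when an insertion is
  undone.\<close>

lemma ex_lr_maximum_dominating:
  assumes inj: "inj p" and j: "j \<in> {1..n}"
  shows "\<exists>i \<in> lr_maxima n p. i \<le> j \<and> p j \<le> p i"
  using j
proof (induction j rule: less_induct)
  case (less j)
  show ?case
  proof (cases "j \<in> lr_maxima n p")
    case True
    then show ?thesis by blast
  next
    case False
    then obtain l where l: "l \<in> {1..<j}" "p j \<le> p l"
      using less.prems by (auto simp: lr_maxima_def not_less)
    then obtain i where "i \<in> lr_maxima n p" "i \<le> l" "p l \<le> p i"
      using less.IH[of l] less.prems by auto
    then show ?thesis using l by (intro bexI[of _ i]) auto
  qed
qed

section \<open>Inserting a new maximum into a permutation\<close>

text \<open>The facts about the cycle alone are kept apart from those about a permutation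
  \<open>p\<close>, because \<open>ex_insertion\<close> has to use them in order to define
  \<open>p\<close>.\<close>

locale insertion =
  fixes n :: nat and L :: "nat set"
  assumes L: "L \<subseteq> {1..n}" "L \<noteq> {}"
begin

abbreviation "N \<equiv> Suc n"
abbreviation "\<sigma> \<equiv> insertion_cycle N L"

lemma finite_L: "finite L"
  using L finite_subset by auto

lemma cycle_new: "\<sigma> N = Min L"
  by (simp add: insertion_cycle_def)

lemma Min_in_L: "Min L \<in> L"
  using finite_L L by simp

lemma Min_le_L: "i \<in> L \<Longrightarrow> Min L \<le> i"
  using finite_L by simp

lemma cycle_outside: "i \<noteq> N \<Longrightarrow> i \<notin> L \<Longrightarrow> \<sigma> i = i"
  by (simp add: insertion_cycle_def)

lemma cycle_next:
  assumes "i \<in> L"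
  shows "\<sigma> i \<in> insert N L" "i < \<sigma> i" "\<And>j. j \<in> insert N L \<Longrightarrow> i < j \<Longrightarrow> \<sigma> i \<le> j"
proof -
  have iN: "i < N" "i \<noteq> N" using assms L by auto
  have *: "\<sigma> i = (LEAST j. j \<in> insert N L \<and> i < j)"
    using assms iN by (simp add: insertion_cycle_def)
  have "\<sigma> i \<in> insert N L \<and> i < \<sigma> i"
    \<comment> \<open>\<open>N\<close> lies above all of \<open>L\<close>, so there is always a
      candidate for the minimum; the maximum of \<open>L\<close> is sent to
      \<open>N\<close>.\<close>
    unfolding * by (rule LeastI[of _ N]) (use iN in simp)
  then show "\<sigma> i \<in> insert N L" "i < \<sigma> i" by auto
  show "\<sigma> i \<le> j" if "j \<in> insert N L" "i < j" for j
    unfolding * by (rule Least_le) (use that in simp)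
qed

lemma cycle_mono:
  assumes "i \<in> L" "j \<in> L" "i < j"
  shows "\<sigma> i \<le> j" "\<sigma> i < \<sigma> j" "\<sigma> i \<in> L"
proof -
  show 1: "\<sigma> i \<le> j" using cycle_next(3)[OF assms(1)] assms by simp
  then show "\<sigma> i < \<sigma> j" using cycle_next(2)[OF assms(2)] by simp
  have "\<sigma> i \<noteq> N" using 1 assms(2) L by auto
  then show "\<sigma> i \<in> L" using cycle_next(1)[OF assms(1)] by simp
qed

text \<open>On \<open>L\<close> the cycle is strictly increasing and misses \<open>Min L\<close>,
  the image of \<open>N\<close>. It is thus injective on the finite set \<open>insert N L\<close>,
  which it maps into itself, and so bijective there.\<close>

lemma cycle_permutes: "\<sigma> permutes {1..N}"
proof -
  have into: "\<sigma> i \<in> insert N L" if "i \<in> insert N L" for i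
    using that cycle_new Min_in_L cycle_next(1) by auto
  have inj: "inj_on \<sigma> (insert N L)"
  proof (rule inj_onI)
    have *: "\<sigma> i \<noteq> Min L" if "i \<in> L" for i
      using cycle_next(2)[OF that] Min_le_L[OF that] by simp
    fix i j assume "i \<in> insert N L" "j \<in> insert N L" "\<sigma> i = \<sigma> j"
    then show "i = j"
      using * cycle_new cycle_mono(2)[of i j] cycle_mono(2)[of j i]
      by (metis insert_iff less_irrefl linorder_neqE_nat)
  qed
  have fin: "finite (insert N L)" using finite_L by simp
  have "\<sigma> ` insert N L = insert N L"
    using endo_inj_surj[OF fin _ inj] into by blast
  then have "bij_betw \<sigma> (insert N L) (insert N L)" using inj by (simp add: bij_betw_def)
  then have "\<sigma> permutes insert N L"
    by (rule bij_imp_permutes) (use cycle_outside in simp)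
  then show ?thesis by (rule permutes_subset) (use L in auto)
qed

lemma cycle_eq_N: "\<sigma> (Max L) = N"
proof -
  have M: "Max L \<in> L" using finite_L L by simp
  have "\<sigma> (Max L) \<notin> L"
    using cycle_next(2)[OF M] Max_ge[OF finite_L] by (meson not_less)
  then show ?thesis using cycle_next(1)[OF M] by simp
qed

section \<open>The permutation after the insertion\<close>

context
  fixes p assumes p: "p permutes {1..n}" and Lp: "L \<subseteq> lr_maxima n p"
begin

abbreviation "q \<equiv> p \<circ> \<sigma>"

lemma p_N: "p N = N"
  using permutes_not_in[OF p] by simp

lemma p_less_N: "i \<in> {1..n} \<Longrightarrow> p i < N"
  using permutes_in_image[OF p, of i] by simp

lemma inserted_permutes: "q permutes {1..N}"
  by (rule permutes_compose[OF cycle_permutes permutes_subset[OF p]]) simp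

text \<open>A left-to-right maximum beats everything before it, and \<open>p N = N\<close> beats all
  values on \<open>{1..n}\<close>. So every step along the cycle, except the one from
  \<open>N\<close> back to \<open>Min L\<close>, raises the value of \<open>p\<close>.\<close>

lemma p_strict_mono_L:
  assumes "i \<in> L" "j \<in> insert N L" "i < j"
  shows "p i < p j"
proof (cases "j = N")
  case True
  then show ?thesis using assms(1) L p_N p_less_N[of i] by auto
next
  case False
  then have "j \<in> lr_maxima n p" "1 \<le> i" using assms L Lp by auto
  then show ?thesis using lr_maxima_less[of j n p i] assms(3) by simp
qed

lemma inserted_L_greater: "i \<in> L \<Longrightarrow> p i < q i"
  using cycle_next[of i] p_strict_mono_L by simp

lemma inserted_ge: "i \<in> {1..n} \<Longrightarrow> p i \<le> q i"
  using inserted_L_greater[of i] cycle_outside[of i] by (cases "i \<in> L") auto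

lemma inserted_N: "q N = p (Min L)" "q N < N"
  using cycle_new Min_in_L L p_less_N by auto

text \<open>Values grow on \<open>L\<close> and stay put elsewhere in \<open>{1..n}\<close>. Hence
  members of \<open>L\<close> remain maxima, as do old maxima before \<open>Min L\<close>. An old
  maximum outside \<open>L\<close> but after some member of \<open>L\<close> is now beaten by the
  last such member, and \<open>N\<close> is beaten by \<open>Max L\<close>, which receives the value
  \<open>N\<close>.\<close>

lemma inserted_lr_maxima:
  "lr_maxima N q = {i \<in> lr_maxima n p. i \<in> L \<or> (\<forall>j \<in> L. i < j)}"
proof (intro equalityI subsetI)
  fix i assume i: "i \<in> lr_maxima N q"
  have "i \<noteq> N"
  proof
    assume "i = N"
    have "Max L \<in> L" using finite_L L by simp
    then have "Max L \<in> {1..<N}" using L by auto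
    then have "q (Max L) < q N" using lr_maxima_less[OF i] \<open>i = N\<close> by blast
    moreover have "q (Max L) = N" using cycle_eq_N p_N by simp
    ultimately show False using inserted_N by simp
  qed
  then have iN: "i \<in> {1..n}" using i by (auto simp: lr_maxima_def)
  show "i \<in> {i \<in> lr_maxima n p. i \<in> L \<or> (\<forall>j \<in> L. i < j)}"
  proof (cases "i \<in> L")
    case True
    then show ?thesis using Lp by auto
  next
    case False
    have qi: "q i = p i" using False iN cycle_outside by simp
    have "p j < p i" if "j \<in> {1..<i}" for j
      using lr_maxima_less[OF i that] inserted_ge[of j] qi that iN by auto
    then have lr: "i \<in> lr_maxima n p" using iN by (auto simp: lr_maxima_def)
    moreover have "i < j" if j: "j \<in> L" for j
    proof (rule ccontr)
      assume "\<not> i < j"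
      then have ji: "j < i" using False j by (cases "i = j") auto
      \<comment> \<open>The last member of \<open>L\<close> before \<open>i\<close>. Its successor
        on the cycle lies beyond \<open>i\<close>, so \<open>q l = p (\<sigma> l)\<close> exceeds
        \<open>p i = q i\<close>.\<close>
      define l where "l = Max {l \<in> L. l < i}"
      have fin: "finite {l \<in> L. l < i}" using finite_L by simp
      have ne: "{l \<in> L. l < i} \<noteq> {}" using j ji by auto
      have l: "l \<in> L" "l < i" using Max_in[OF fin ne] by (auto simp: l_def)
      have "\<not> \<sigma> l < i"
      proof
        assume *: "\<sigma> l < i"
        then have "\<sigma> l \<in> L" using cycle_next(1)[OF l(1)] iN by auto
        then have "\<sigma> l \<le> l" unfolding l_def using * fin by (intro Max_ge) (auto simp: l_def)
        then show False using cycle_next(2)[OF l(1)] by simp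
      qed
      then have il: "i < \<sigma> l" using False cycle_next(1)[OF l(1)] iN
        by (metis \<open>i \<noteq> N\<close> insert_iff linorder_neqE_nat)
      have "p i < p (\<sigma> l)"
      proof (cases "\<sigma> l = N")
        case True
        then show ?thesis using p_N p_less_N iN by simp
      next
        case False
        then have "\<sigma> l \<in> lr_maxima n p" using cycle_next(1)[OF l(1)] Lp by auto
        then show ?thesis using lr_maxima_less[of "\<sigma> l" n p i] il iN by auto
      qed
      moreover have "q l < q i" using lr_maxima_less[OF i, of l] l L by auto
      ultimately show False using qi by simp
    qed
    ultimately show ?thesis by blast
  qed
next
  fix i assume "i \<in> {i \<in> lr_maxima n p. i \<in> L \<or> (\<forall>j \<in> L. i < j)}"
  then have lr: "i \<in> lr_maxima n p" and i: "i \<in> L \<or> (\<forall>j \<in> L. i < j)" by auto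
  have iN: "i \<in> {1..n}" using lr by (auto simp: lr_maxima_def)
  have "q j < q i" if j: "j \<in> {1..<i}" for j
  proof (cases "j \<in> L")
    case True
    then have "i \<in> L" using i j by force
    then have "\<sigma> j \<in> L" "\<sigma> j < \<sigma> i" "\<sigma> i \<in> insert N L"
      using cycle_mono[of j i] True j cycle_next(1) by auto
    then show ?thesis using p_strict_mono_L by simp
  next
    case False
    then have "q j = p j" using j iN cycle_outside by simp
    then show ?thesis using lr_maxima_less[OF lr j] inserted_ge[OF iN] by simp
  qed
  then show "i \<in> lr_maxima N q" using iN by (auto simp: lr_maxima_def)
qed

text \<open>The threshold \<open>q N\<close> equals \<open>p (Min L)\<close>. Members of
  \<open>L\<close> had at least this value under \<open>p\<close> and have gained; by
  \<open>inserted_lr_maxima\<close> all other maxima of \<open>q\<close> precede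
  \<open>Min L\<close>, where the maxima property of \<open>Min L\<close> keeps them below
  it.\<close>

lemma inserted_recover_L: "L = {i \<in> lr_maxima N q. q N < q i}"
proof -
  have Min: "q N = p (Min L)" using inserted_N by simp
  have "q N < q i" if "i \<in> L" for i
  proof -
    have "p (Min L) \<le> p i"
      using that Min_le_L[OF that] p_strict_mono_L[of "Min L" i] Min_in_L
      by (cases "Min L = i") auto
    then show ?thesis using inserted_L_greater[OF that] Min by simp
  qed
  moreover have "i \<in> L" if "i \<in> lr_maxima n p" "\<forall>j \<in> L. i < j" "q N < q i" for i
  proof (rule ccontr)
    assume "i \<notin> L"
    moreover have "i \<in> {1..n}" using that(1) by (auto simp: lr_maxima_def)
    ultimately have "q i = p i" using cycle_outside by simp
    moreover have "p i < p (Min L)"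
      using lr_maxima_less[of "Min L" n p i] that(2) Min_in_L Lp \<open>i \<in> {1..n}\<close> by auto
    ultimately show False using that(3) Min by simp
  qed
  ultimately show ?thesis unfolding inserted_lr_maxima using Lp by blast
qed

text \<open>Only positions in \<open>L\<close> and \<open>N\<close> are affected: the former were
  weak excedances by \<open>lr_maxima_ge\<close> and have only grown, and
  \<open>q N < N\<close>.\<close>

lemma inserted_weak_excedances: "weak_excedances N q = weak_excedances n p"
proof -
  have "i \<le> q i \<longleftrightarrow> i \<le> p i" if "i \<in> {1..n}" for i
  proof (cases "i \<in> L")
    case True
    then have "i \<le> p i" using lr_maxima_ge[OF p] Lp by auto
    then show ?thesis using inserted_ge[OF that] by simp
  next
    case False
    then show ?thesis using cycle_outside that by simp
  qed
  moreover have "{1..N} = insert N {1..n}" by auto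
  ultimately show ?thesis using inserted_N(2) unfolding weak_excedances_def by auto
qed

end

end

text \<open>\<open>inserted_recover_L\<close> dictates the choice of \<open>L\<close>, and
  \<open>p\<close> must then be \<open>q\<close> composed with the inverse cycle. It remains to see
  that \<open>p\<close> fixes \<open>Suc n\<close> and that \<open>L\<close> consists of
  left-to-right maxima of \<open>p\<close>.\<close>

lemma ex_insertion:
  assumes q: "q permutes {1..Suc n}" and qN: "q (Suc n) \<noteq> Suc n"
  shows "\<exists>p L. p permutes {1..n} \<and> L \<subseteq> lr_maxima n p \<and> L \<noteq> {} \<and>
           q = p \<circ> insertion_cycle (Suc n) L"
proof -
  define L where "L = {i \<in> lr_maxima (Suc n) q. q (Suc n) < q i}"
  have injq: "inj q" using permutes_inj[OF q] .
  have bound: "q i \<le> Suc n" if "i \<in> {1..Suc n}" for i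
    using permutes_in_image[OF q, of i] that by simp
  obtain t where t: "t \<in> {1..Suc n}" "q t = Suc n"
  proof -
    have "Suc n \<in> q ` {1..Suc n}" using permutes_image[OF q] by simp
    then show thesis using that by (metis imageE)
  qed
  have tL: "t \<in> L"
  proof -
    have "q j < q t" if "j \<in> {1..<t}" for j
    proof -
      have "q j \<noteq> q t" using inj_eq[OF injq] that by simp
      then show ?thesis using bound[of j] that t by simp
    qed
    moreover have "q (Suc n) < q t"
      using bound[of "Suc n"] qN t by simp
    ultimately show ?thesis using t by (auto simp: L_def lr_maxima_def)
  qed
  have "Suc n \<notin> L" by (simp add: L_def)
  then have "L \<subseteq> {1..n}" by (auto simp: L_def lr_maxima_def le_Suc_eq)
  then interpret insertion n L
    by unfold_locales (use tL in auto)
  have inv: "inv \<sigma> permutes {1..N}" using permutes_inv[OF cycle_permutes] .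
  define p where "p = q \<circ> inv \<sigma>"
  have q_eq: "q = p \<circ> \<sigma>"
    using permutes_inv_o(2)[OF cycle_permutes] by (simp add: p_def comp_assoc)
  have pN: "p permutes {1..N}"
    unfolding p_def by (rule permutes_compose[OF inv q])
  \<comment> \<open>The position \<open>t\<close> carries the largest value, so no left-to-right
    maximum comes after it. The cycle therefore sends \<open>t = Max L\<close> to \<open>N\<close>,
    whence \<open>p N = q t = N\<close>.\<close>
  have "y \<le> t" if y: "y \<in> L" for y
  proof (rule ccontr)
    assume "\<not> y \<le> t"
    then have "q t < q y" using lr_maxima_less[of y N q t] y t(1) by (simp add: L_def)
    then show False using bound[of y] t(2) y L by auto
  qed
  then have Max: "Max L = t" using tL finite_L by (intro Max_eqI)
  have "p N = N" using fun_cong[OF q_eq, of t] cycle_eq_N t Max by simp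
  then have p: "p permutes {1..n}"
    using pN by (intro permutes_superset[OF pN]) (auto simp: le_Suc_eq)
  have lr: "i \<in> lr_maxima N q" if "i \<in> L" for i using that by (simp add: L_def)
  have "L \<subseteq> lr_maxima n p"
  proof
    fix i assume i: "i \<in> L"
    have in1: "i \<in> {1..n}" using i L by auto
    \<comment> \<open>The value \<open>p i\<close> is the value of \<open>q\<close> at the
      predecessor of \<open>i\<close> on the cycle, which is \<open>N\<close> for
      \<open>i = Min L\<close> and an earlier member \<open>h\<close> of \<open>L\<close>
      otherwise.\<close>
    have val: "(q N = p i \<and> i = Min L) \<or> (\<exists>h \<in> L. h < i \<and> q h = p i \<and> \<sigma> h = i)"
    proof (cases "i = Min L")
      case True
      then show ?thesis using q_eq cycle_new by (metis comp_apply)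
    next
      case False
      have "i \<in> \<sigma> ` {1..N}" using permutes_image[OF cycle_permutes] in1 by auto
      then obtain h where h: "\<sigma> h = i" "h \<in> {1..N}" by blast
      have "h \<noteq> N" using h False cycle_new by auto
      moreover have "h \<in> L"
      proof (rule ccontr)
        assume "h \<notin> L"
        then have "h = i" using h cycle_outside \<open>h \<noteq> N\<close> by simp
        then show False using i \<open>h \<notin> L\<close> by simp
      qed
      ultimately show ?thesis using h cycle_next(2)[of h] q_eq by (metis comp_apply)
    qed
    have ge: "q N \<le> p i" using val by (auto simp: L_def)
    have "p j < p i" if j: "j \<in> {1..<i}" for j
    proof (cases "j \<in> L")
      case True
      \<comment> \<open>Both \<open>i\<close> and \<open>j\<close> lie on the cycle, so their
        predecessors are compared. That of \<open>j\<close> is either \<open>N\<close>, below the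
        threshold for \<open>L\<close>, or some \<open>g < h\<close> in \<open>L\<close>, and
        \<open>q\<close> increases along its left-to-right maxima.\<close>
      then have "i \<noteq> Min L" using Min_le_L[OF True] j by auto
      then obtain h where h: "h \<in> L" "q h = p i" "\<sigma> h = i" using val by blast
      have jn: "j \<in> {1..n}" using j in1 by auto
      have "j \<le> h"
        using cycle_mono(1)[OF h(1) True] h j by (meson atLeastLessThan_iff leD not_le)
      show ?thesis
      proof (cases "j = Min L")
        case True
        then have "p j = q N" using q_eq cycle_new by (metis comp_apply)
        then show ?thesis using h by (auto simp: L_def)
      next
        case False
        have "j \<in> \<sigma> ` {1..N}" using permutes_image[OF cycle_permutes] jn by auto
        then obtain g where g: "\<sigma> g = j" by blast
        have "g \<noteq> N" using g False cycle_new by auto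
        then have gL: "g \<in> L" using g cycle_outside True by metis
        then have "g < h" using g cycle_next(2)[of g] \<open>j \<le> h\<close> by simp
        then have "q g < q h" using lr_maxima_less[OF lr[OF h(1)], of g] gL L by auto
        moreover have "q g = p j" using q_eq g by (metis comp_apply)
        ultimately show ?thesis using h by simp
      qed
    next
      case False
      have qj: "q j = p j" using False j in1 cycle_outside[of j] fun_cong[OF q_eq, of j] by simp
      \<comment> \<open>Off the cycle \<open>p j = q j\<close> is bounded through a dominating
        maximum \<open>m\<close> of \<open>q\<close>. If \<open>m\<close> is in \<open>L\<close>,
        then \<open>m \<le> h\<close> and so \<open>q m \<le> q h = p i\<close>; if not,
        \<open>q m \<le> q N \<le> p i\<close> by the choice of \<open>L\<close>. Injectivity makes
        the bound strict.\<close>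
      obtain m where m: "m \<in> lr_maxima N q" "m \<le> j" "q j \<le> q m"
        using ex_lr_maximum_dominating[OF injq, of j N] j in1 by auto
      show ?thesis
      proof (cases "m \<in> L")
        case True
        then have "m < i" "m \<noteq> j" using m j False by auto
        have "i \<noteq> Min L" using Min_le_L[OF True] \<open>m < i\<close> by auto
        then obtain h where h: "h \<in> L" "q h = p i" "\<sigma> h = i" using val by blast
        have "m \<le> h"
          using cycle_mono(1)[OF h(1) True] h \<open>m < i\<close> by (meson leD not_le)
        then have "q m \<le> q h"
          using lr_maxima_less[OF lr[OF h(1)], of m] True L by (cases "m = h") auto
        moreover have "q j \<noteq> q m" using inj_eq[OF injq] \<open>m \<noteq> j\<close> by simp
        ultimately show ?thesis using qj h m by simp
      next
        case False
        then have "q m \<le> q N" using m by (auto simp: L_def)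
        moreover have "q j \<noteq> q N" using inj_eq[OF injq] j in1 by simp
        ultimately show ?thesis using qj ge m by simp
      qed
    qed
    then show "i \<in> lr_maxima n p" using in1 by (auto simp: lr_maxima_def)
  qed
  then show ?thesis using p q_eq L by blast
qed


section \<open>Building tableaux step by step along the border\<close>

definition empty_tableau :: tableau where
  "empty_tableau = \<lparr>shape = [], width = 0, entry = (\<lambda>_. undefined)\<rparr>"

definition add_row :: "tableau \<Rightarrow> tableau" where
  "add_row T = T\<lparr>shape := shape T @ [0]\<rparr>"

text \<open>Diagrams are left-justified, so the new column takes index 0 and the old ones move up by
  one. The value \<open>undefined\<close> below the last row keeps the filling extensional.\<close>

definition add_column :: "nat set \<Rightarrow> tableau \<Rightarrow> tableau" where
  "add_column R T =
     \<lparr>shape = map Suc (shape T), width = Suc (width T),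
      entry = (\<lambda>(r, c). case c of
        0 \<Rightarrow> if r < length (shape T) then if r \<in> R then 1 else 0 else undefined
      | Suc c' \<Rightarrow> entry T (r, c'))\<rparr>"

text \<open>In a permutation tableau these are the rows that can receive a 1 in a new leftmost
  column without breaking condition (2).\<close>

definition unrestricted_rows :: "tableau \<Rightarrow> nat set" where
  "unrestricted_rows T = {r. r < length (shape T) \<and>
     (\<forall>c < shape T ! r. entry T (r, c) = 0 \<longrightarrow> \<not> (\<exists>r' < r. entry T (r', c) = 1))}"

text \<open>One rule for each kind of border step, taken from northeast to southwest. It supplies
  the induction for all statements about \<open>\<Phi>\<close>.\<close>

inductive built :: "tableau \<Rightarrow> bool" where
  empty: "built empty_tableau"
| row: "built T \<Longrightarrow> built (add_row T)"
| column: "built T \<Longrightarrow> R \<subseteq> unrestricted_rows T \<Longrightarrow> R \<noteq> {} \<Longrightarrow> built (add_column R T)"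

lemma empty_tableau_simps [simp]:
  "shape empty_tableau = []" "width empty_tableau = 0" "entry empty_tableau b = undefined"
  by (simp_all add: empty_tableau_def)

lemma add_row_simps [simp]:
  "shape (add_row T) = shape T @ [0]" "width (add_row T) = width T" "entry (add_row T) = entry T"
  by (simp_all add: add_row_def)

lemma add_column_simps [simp]:
  "shape (add_column R T) = map Suc (shape T)" "width (add_column R T) = Suc (width T)"
  "r < length (shape T) \<Longrightarrow> entry (add_column R T) (r, 0) = (if r \<in> R then 1 else 0)"
  "\<not> r < length (shape T) \<Longrightarrow> entry (add_column R T) (r, 0) = undefined"
  "entry (add_column R T) (r, Suc c) = entry T (r, c)"
  by (simp_all add: add_column_def)

lemma unrestricted_rows_less: "r \<in> unrestricted_rows T \<Longrightarrow> r < length (shape T)"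
  by (simp add: unrestricted_rows_def)

lemma young_diagram_append_0: "young_diagram (l @ [0]) = young_diagram l"
  by (auto simp: young_diagram_def nth_append split: if_splits)

lemma young_diagram_map_Suc:
  "(r, 0) \<in> young_diagram (map Suc l) \<longleftrightarrow> r < length l"
  "(r, Suc c) \<in> young_diagram (map Suc l) \<longleftrightarrow> (r, c) \<in> young_diagram l"
  by (auto simp: young_diagram_def)

lemma unrestricted_rows_add_row:
  "unrestricted_rows (add_row T) = insert (length (shape T)) (unrestricted_rows T)"
  by (auto simp: unrestricted_rows_def nth_append)

text \<open>A row of \<open>R\<close> gets a 1 and stays unrestricted; any other row gets a 0, which
  restricts it exactly when a row of \<open>R\<close> lies above. The recursion has the same form as
  \<open>inserted_lr_maxima\<close>.\<close>

lemma unrestricted_rows_add_column: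
  assumes "R \<subseteq> unrestricted_rows T"
  shows "unrestricted_rows (add_column R T) =
    {r \<in> unrestricted_rows T. r \<in> R \<or> (\<forall>r' \<in> R. r < r')}"
proof -
  have R: "r < length (shape T)" if "r \<in> R" for r
    using that assms unrestricted_rows_less by blast
  have "r \<in> unrestricted_rows (add_column R T) \<longleftrightarrow>
      r \<in> unrestricted_rows T \<and> (r \<in> R \<or> \<not> (\<exists>r' \<in> R. r' < r))" for r
  proof (cases "r < length (shape T)")
    case True
    have "(\<exists>r' < r. entry (add_column R T) (r', 0) = 1) \<longleftrightarrow> (\<exists>r' \<in> R. r' < r)"
      using True R by (auto split: if_splits)
    then show ?thesis
      using True by (auto simp: unrestricted_rows_def All_less_Suc2)
  qed (auto simp: unrestricted_rows_def)
  moreover have "r \<in> R \<or> \<not> (\<exists>r' \<in> R. r' < r) \<longleftrightarrow> r \<in> R \<or> (\<forall>r' \<in> R. r < r')" for r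
    by (metis linorder_neqE_nat not_less_iff_gr_or_eq)
  ultimately show ?thesis by blast
qed

section \<open>Recursive structure of permutation tableaux\<close>

lemma in_permutation_tableaux_iff:
  "T \<in> permutation_tableaux k m \<longleftrightarrow>
     length (shape T) = k \<and> width T = m \<and>
     sorted_wrt (\<ge>) (shape T) \<and> (\<forall>x \<in> set (shape T). x \<le> m) \<and>
     (\<forall>b. b \<in> young_diagram (shape T) \<longrightarrow> entry T b \<in> {0, 1}) \<and>
     (\<forall>b. b \<notin> young_diagram (shape T) \<longrightarrow> entry T b = undefined) \<and>
     (\<forall>c < m. \<exists>r. (r, c) \<in> young_diagram (shape T) \<and> entry T (r, c) = 1) \<and>
     (\<forall>r c. (r, c) \<in> young_diagram (shape T) \<longrightarrow> entry T (r, c) = 0 \<longrightarrow>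
        (\<exists>r' < r. entry T (r', c) = 1) \<longrightarrow> (\<exists>c' < c. entry T (r, c') = 1) \<longrightarrow> False)"
proof -
  have "f \<in> Y \<rightarrow>\<^sub>E A \<longleftrightarrow> (\<forall>b. b \<in> Y \<longrightarrow> f b \<in> A) \<and> (\<forall>b. b \<notin> Y \<longrightarrow> f b = undefined)"
    for f :: "nat \<times> nat \<Rightarrow> nat" and Y A
    unfolding PiE_iff extensional_def by blast
  then show ?thesis
    unfolding permutation_tableaux_def mem_Collect_eq by blast
qed

lemma add_row_in_permutation_tableaux_iff:
  "add_row T \<in> permutation_tableaux (Suc k) m \<longleftrightarrow> T \<in> permutation_tableaux k m"
  unfolding in_permutation_tableaux_iff by (simp add: young_diagram_append_0 sorted_wrt_append)

text \<open>Condition (1) for the new column is \<open>R \<noteq> {}\<close>. For condition (2), a 0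
  in the new column has nothing to its left, while a 0 in an old column gains a 1 to its left
  exactly when its row is in \<open>R\<close>; forbidding this is
  \<open>R \<subseteq> unrestricted_rows T\<close>.\<close>

lemma add_column_in_permutation_tableaux_iff:
  assumes R: "R \<subseteq> {..<k}"
  shows "add_column R T \<in> permutation_tableaux k (Suc m) \<longleftrightarrow>
    T \<in> permutation_tableaux k m \<and> R \<subseteq> unrestricted_rows T \<and> R \<noteq> {}"
proof (cases "length (shape T) = k")
  case len: True
  let ?C = "add_column R T" and ?Y = "young_diagram (shape T)"
  let ?Y' = "young_diagram (map Suc (shape T))"
  have pair: "(\<forall>b. P b) \<longleftrightarrow> (\<forall>r. P (r, 0)) \<and> (\<forall>r c. P (r, Suc c))" for P :: "nat \<times> nat \<Rightarrow> bool"
    by (metis surj_pair not0_implies_Suc)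
  have e0: "r < k \<Longrightarrow> entry ?C (r, 0) = (if r \<in> R then 1 else 0)"
    "\<not> r < k \<Longrightarrow> entry ?C (r, 0) = undefined" for r
    using len by simp_all
  \<comment> \<open>The bound \<open>r < k\<close> matters: beyond the last row the entry is
    \<open>undefined\<close>, of which it is not known whether it equals 1.\<close>
  have one: "r < k \<and> entry ?C (r, 0) = 1 \<longleftrightarrow> r \<in> R" for r
    using R by (cases "r < k") (auto simp: e0)
  have sorted: "sorted_wrt (\<ge>) (map Suc (shape T)) \<longleftrightarrow> sorted_wrt (\<ge>) (shape T)"
    by (simp add: sorted_wrt_map)
  have bounds: "(\<forall>x \<in> set (map Suc (shape T)). x \<le> Suc m) \<longleftrightarrow> (\<forall>x \<in> set (shape T). x \<le> m)"
    by simp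
  have vals: "(\<forall>b. b \<in> ?Y' \<longrightarrow> entry ?C b \<in> {0, 1}) \<longleftrightarrow> (\<forall>b. b \<in> ?Y \<longrightarrow> entry T b \<in> {0, 1})"
    unfolding pair[of "\<lambda>b. b \<in> ?Y' \<longrightarrow> entry ?C b \<in> {0, 1}"] young_diagram_map_Suc
    using len by (auto simp: e0)
  have ext: "(\<forall>b. b \<notin> ?Y' \<longrightarrow> entry ?C b = undefined) \<longleftrightarrow> (\<forall>b. b \<notin> ?Y \<longrightarrow> entry T b = undefined)"
    unfolding pair[of "\<lambda>b. b \<notin> ?Y' \<longrightarrow> entry ?C b = undefined"] young_diagram_map_Suc
    using len by (auto simp: e0)
  have cols: "(\<forall>c < Suc m. \<exists>r. (r, c) \<in> ?Y' \<and> entry ?C (r, c) = 1) \<longleftrightarrow>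
      R \<noteq> {} \<and> (\<forall>c < m. \<exists>r. (r, c) \<in> ?Y \<and> entry T (r, c) = 1)"
    unfolding All_less_Suc2 young_diagram_map_Suc len one add_column_simps by blast
  have le: "(\<forall>r c. (r, c) \<in> ?Y' \<longrightarrow> entry ?C (r, c) = 0 \<longrightarrow>
        (\<exists>r' < r. entry ?C (r', c) = 1) \<longrightarrow> (\<exists>c' < c. entry ?C (r, c') = 1) \<longrightarrow> False) \<longleftrightarrow>
      R \<subseteq> unrestricted_rows T \<and>
      (\<forall>r c. (r, c) \<in> ?Y \<longrightarrow> entry T (r, c) = 0 \<longrightarrow>
        (\<exists>r' < r. entry T (r', c) = 1) \<longrightarrow> (\<exists>c' < c. entry T (r, c') = 1) \<longrightarrow> False)"
    (is "?l \<longleftrightarrow> ?r")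
  proof -
    have "?l \<longleftrightarrow> (\<forall>r c. (r, c) \<in> ?Y \<longrightarrow> entry T (r, c) = 0 \<longrightarrow> (\<exists>r' < r. entry T (r', c) = 1) \<longrightarrow>
        (entry ?C (r, 0) = 1 \<or> (\<exists>c' < c. entry T (r, c') = 1)) \<longrightarrow> False)"
      unfolding pair[of "\<lambda>(r, c). (r, c) \<in> ?Y' \<longrightarrow> entry ?C (r, c) = 0 \<longrightarrow>
        (\<exists>r' < r. entry ?C (r', c) = 1) \<longrightarrow> (\<exists>c' < c. entry ?C (r, c') = 1) \<longrightarrow> False",
          unfolded split_paired_All prod.case] young_diagram_map_Suc Ex_less_Suc2
      by simp
    also have "\<dots> \<longleftrightarrow> (\<forall>r c. (r, c) \<in> ?Y \<longrightarrow> entry T (r, c) = 0 \<longrightarrow> (\<exists>r' < r. entry T (r', c) = 1) \<longrightarrow>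
        (r \<in> R \<or> (\<exists>c' < c. entry T (r, c') = 1)) \<longrightarrow> False)"
      using len by (auto simp: e0 young_diagram_def split: if_splits)
    also have "\<dots> \<longleftrightarrow> ?r"
    proof -
      have "R \<subseteq> unrestricted_rows T \<longleftrightarrow> (\<forall>r c. (r, c) \<in> ?Y \<longrightarrow> entry T (r, c) = 0 \<longrightarrow>
          (\<exists>r' < r. entry T (r', c) = 1) \<longrightarrow> r \<in> R \<longrightarrow> False)"
        using R unfolding unrestricted_rows_def young_diagram_def len subset_iff mem_Collect_eq
          prod.case lessThan_iff by blast
      then show ?thesis by blast
    qed
    finally show ?thesis .
  qed
  show ?thesis
    unfolding in_permutation_tableaux_iff add_column_simps sorted vals ext cols le bounds
      length_map len nat.inject by blast
next
  case False
  then show ?thesis by (simp add: in_permutation_tableaux_iff)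
qed

text \<open>The cases are those of the last border step: it is vertical if the last row is empty,
  and otherwise horizontal, with column 0 meeting every row.\<close>

lemma permutation_tableau_cases:
  assumes T: "T \<in> permutation_tableaux k m"
  obtains "T = empty_tableau" "k = 0" "m = 0"
  | T' k' where "T = add_row T'" "k = Suc k'" "T' \<in> permutation_tableaux k' m"
  | T' R m' where "T = add_column R T'" "m = Suc m'" "T' \<in> permutation_tableaux k m'"
      "R \<subseteq> unrestricted_rows T'" "R \<noteq> {}"
proof -
  note T' = T[unfolded in_permutation_tableaux_iff]
  have len: "length (shape T) = k" "width T = m" using T' by auto
  consider "k = 0" "m = 0" | "k = 0" "m \<noteq> 0" | "k \<noteq> 0" "last (shape T) = 0"
    | "k \<noteq> 0" "last (shape T) \<noteq> 0" by blast
  then show thesis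
  proof cases
    case 1
    then have "entry T b = undefined" for b using T' by (cases b) (auto simp: young_diagram_def)
    then have "T = empty_tableau"
      using 1 len by (intro tableau.equality) (auto simp: fun_eq_iff)
    then show thesis using 1 that(1) by blast
  next
    case 2
    \<comment> \<open>Without rows, a column of the rectangle would have no box to hold its
      1.\<close>
    then have "young_diagram (shape T) = {}" using len by (simp add: young_diagram_def)
    then show thesis using T' 2 by blast
  next
    case 3
    define T0 where "T0 = T\<lparr>shape := butlast (shape T)\<rparr>"
    have "shape T \<noteq> []" using 3 len by auto
    then have eq: "T = add_row T0"
      using 3 append_butlast_last_id[of "shape T"]
      by (intro tableau.equality) (auto simp: T0_def)
    obtain k' where k: "k = Suc k'" using 3 not0_implies_Suc by blast
    show thesis using that(2)[OF eq k] T add_row_in_permutation_tableaux_iff eq k by metis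
  next
    case 4
    define R where "R = {r. r < k \<and> entry T (r, 0) = 1}"
    define T0 where "T0 = \<lparr>shape = map (\<lambda>x. x - 1) (shape T), width = m - 1,
      entry = (\<lambda>(r, c). entry T (r, Suc c))\<rparr>"
    \<comment> \<open>The last row is the shortest, so all rows are nonempty and can lose their
      first box.\<close>
    have pos: "0 < x" if "x \<in> set (shape T)" for x
    proof -
      obtain l y where l: "shape T = l @ [y]" using 4 len by (metis length_0_conv rev_exhaust)
      then show ?thesis using T' that 4 by (force simp: sorted_wrt_append)
    qed
    have "last (shape T) \<in> set (shape T)" using 4 len by (intro last_in_set) auto
    then have "m \<noteq> 0" using T' 4 by auto
    then obtain m' where m: "m = Suc m'" using not0_implies_Suc by blast
    have Y0: "(r, 0) \<in> young_diagram (shape T) \<longleftrightarrow> r < k" for r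
      using pos len by (auto simp: young_diagram_def)
    have eq: "T = add_column R T0"
    proof (rule tableau.equality)
      show "shape T = shape (add_column R T0)"
        using pos by (simp add: T0_def comp_def map_idI)
      show "width T = width (add_column R T0)" using m len by (simp add: T0_def)
      have "entry T (r, c) = entry (add_column R T0) (r, c)" for r c
      proof (cases c)
        case 0
        have "entry T (r, 0) = (if r < k then if r \<in> R then 1 else 0 else undefined)"
          using T' Y0[of r] by (auto simp: R_def)
        then show ?thesis using 0 len by (simp add: T0_def)
      qed (simp add: T0_def)
      then show "entry T = entry (add_column R T0)" by (auto simp: fun_eq_iff)
    qed simp
    have "R \<subseteq> {..<k}" by (auto simp: R_def)
    from that(3)[OF eq m] add_column_in_permutation_tableaux_iff[OF this, of T0 m'] T eq m
    show thesis by metis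
  qed
qed

lemma built_imp_permutation_tableau:
  "built T \<Longrightarrow> T \<in> permutation_tableaux (length (shape T)) (width T)"
proof (induction rule: built.induct)
  case empty
  then show ?case by (simp add: in_permutation_tableaux_iff young_diagram_def)
next
  case (row T)
  then show ?case using add_row_in_permutation_tableaux_iff by simp
next
  case (column T R)
  then have "R \<subseteq> {..<length (shape T)}" using unrestricted_rows_less by blast
  then show ?case using column add_column_in_permutation_tableaux_iff by simp
qed

lemma permutation_tableau_imp_built:
  "T \<in> permutation_tableaux k m \<Longrightarrow> built T"
proof (induction "k + m" arbitrary: T k m)
  case 0
  from 0(2) show ?case
    by (cases rule: permutation_tableau_cases) (use 0 built.empty in auto)
next
  case (Suc n)
  from Suc.prems show ?case
    by (cases rule: permutation_tableau_cases) (use Suc built.row built.column in auto)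
qed

lemma in_permutation_tableaux_iff_built:
  "T \<in> permutation_tableaux k m \<longleftrightarrow> built T \<and> length (shape T) = k \<and> width T = m"
proof
  assume T: "T \<in> permutation_tableaux k m"
  then show "built T \<and> length (shape T) = k \<and> width T = m"
    using permutation_tableau_imp_built[OF T] unfolding in_permutation_tableaux_iff by blast
next
  assume "built T \<and> length (shape T) = k \<and> width T = m"
  then show "T \<in> permutation_tableaux k m"
    using built_imp_permutation_tableau by blast
qed

section \<open>The labels of the border\<close>

text \<open>The renaming of the old border steps when a new column takes index 0.\<close>

fun shift_step :: "step \<Rightarrow> step" where
  "shift_step (Vertical r) = Vertical r"
| "shift_step (Horizontal c) = Horizontal (Suc c)"

lemma inj_shift_step: "inj shift_step"
proof (rule injI)
  show "s = t" if "shift_step s = shift_step t" for s t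
    using that by (cases s; cases t) auto
qed

lemma shift_step_neq: "shift_step s \<noteq> Horizontal 0"
  by (cases s) auto

lemma border_append_0: "border r c (ls @ [0]) = border r c ls @ [Vertical (r + length ls)]"
  by (induction ls arbitrary: r c) auto

lemma border_map_Suc:
  "border r (Suc c) (map Suc ls) = map shift_step (border r c ls) @ [Horizontal 0]"
proof (induction ls arbitrary: r c)
  case Nil
  have "[0..<Suc c] = 0 # map Suc [0..<c]"
    by (simp add: upt_conv_Cons map_Suc_upt del: upt_Suc)
  then have "rev [0..<Suc c] = map Suc (rev [0..<c]) @ [0]"
    by (simp only: rev.simps rev_map)
  then show ?case by (simp add: comp_def del: upt_Suc)
next
  case (Cons l ls)
  have "rev [Suc l..<Suc c] = map Suc (rev [l..<c])"
    by (simp only: rev_map[symmetric] map_Suc_upt)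
  then show ?case using Cons by (simp add: comp_def del: upt_Suc)
qed

text \<open>Both constructions extend the path at its southwest end only, which is why old steps
  keep their labels.\<close>

lemma partition_path_simps [simp]:
  "partition_path empty_tableau = []"
  "partition_path (add_row T) = partition_path T @ [Vertical (length (shape T))]"
  "partition_path (add_column R T) = map shift_step (partition_path T) @ [Horizontal 0]"
  by (simp_all add: partition_path_def border_append_0 border_map_Suc)

lemma set_partition_path:
  "built T \<Longrightarrow> set (partition_path T) = Vertical ` {..<length (shape T)} \<union> Horizontal ` {..<width T}"
proof (induction rule: built.induct)
  case (column T R)
  have "{..<Suc (width T)} = insert 0 (Suc ` {..<width T})"
    by (rule lessThan_Suc_eq_insert_0)
  then show ?case using column by (simp add: image_Un image_image)
qed (auto simp: lessThan_Suc)

lemma length_partition_path: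
  "built T \<Longrightarrow> length (partition_path T) = length (shape T) + width T"
  by (induction rule: built.induct) auto

lemma distinct_partition_path: "built T \<Longrightarrow> distinct (partition_path T)"
proof (induction rule: built.induct)
  case (row T)
  then show ?case using set_partition_path[of T] by auto
next
  case (column T R)
  have "Horizontal 0 \<notin> shift_step ` set (partition_path T)"
    using shift_step_neq by (metis imageE)
  then show ?case
    using column inj_on_subset[OF inj_shift_step] by (simp add: distinct_map)
qed simp

text \<open>The path visits no step twice, so the definite description in \<open>label_of\<close> is
  well defined. Labels start at 1, list positions at 0.\<close>

lemma label_of_eqI:
  assumes "built T" "i \<in> {1..length (partition_path T)}" "partition_path T ! (i - 1) = s"
  shows "label_of T s = i"
  unfolding label_of_def
proof (rule the_equality)
  fix j assume j: "j \<in> {1..length (partition_path T)} \<and> partition_path T ! (j - 1) = s"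
  then have "j - 1 = i - 1"
    using assms nth_eq_iff_index_eq[OF distinct_partition_path[OF assms(1)], of "j - 1" "i - 1"]
    by fastforce
  then show "j = i" using j assms(2) by auto
qed (use assms in simp)

lemma label_of_in_path:
  assumes "built T" "s \<in> set (partition_path T)"
  shows "label_of T s \<in> {1..length (partition_path T)}"
    "partition_path T ! (label_of T s - 1) = s"
proof -
  obtain i where "i < length (partition_path T)" "partition_path T ! i = s"
    using assms(2) by (auto simp: in_set_conv_nth)
  moreover from this have "label_of T s = Suc i" using assms(1) by (intro label_of_eqI) auto
  ultimately show "label_of T s \<in> {1..length (partition_path T)}"
    "partition_path T ! (label_of T s - 1) = s"
    by auto
qed

lemma ex_label:
  assumes "built T" "i \<in> {1..length (partition_path T)}"
  obtains s where "s \<in> set (partition_path T)" "i = label_of T s"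
proof
  show "partition_path T ! (i - 1) \<in> set (partition_path T)" using assms(2) by (intro nth_mem) auto
  show "i = label_of T (partition_path T ! (i - 1))" using label_of_eqI[OF assms refl] by simp
qed

lemma label_of_add_row:
  assumes "built T"
  shows "s \<in> set (partition_path T) \<Longrightarrow> label_of (add_row T) s = label_of T s"
    "label_of (add_row T) (Vertical (length (shape T))) = Suc (length (partition_path T))"
proof -
  note eqI = label_of_eqI[OF built.row[OF assms]]
  show "label_of (add_row T) s = label_of T s" if "s \<in> set (partition_path T)"
    using label_of_in_path[OF assms that] by (intro eqI) (auto simp: nth_append)
  show "label_of (add_row T) (Vertical (length (shape T))) = Suc (length (partition_path T))"
    by (rule eqI) simp_all
qed

lemma label_of_add_column:
  assumes "built T" "R \<subseteq> unrestricted_rows T" "R \<noteq> {}"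
  shows "s \<in> set (partition_path T) \<Longrightarrow> label_of (add_column R T) (shift_step s) = label_of T s"
    "label_of (add_column R T) (Horizontal 0) = Suc (length (partition_path T))"
proof -
  note eqI = label_of_eqI[OF built.column[OF assms]]
  show "label_of (add_column R T) (shift_step s) = label_of T s" if "s \<in> set (partition_path T)"
    using label_of_in_path[OF assms(1) that] by (intro eqI) (auto simp: nth_append)
  show "label_of (add_column R T) (Horizontal 0) = Suc (length (partition_path T))"
    by (rule eqI) (simp_all add: nth_append)
qed

section \<open>Labels of the rows and their order\<close>

abbreviation row_label :: "tableau \<Rightarrow> nat \<Rightarrow> nat" where
  "row_label T r \<equiv> label_of T (Vertical r)"

lemma Vertical_in_path: "built T \<Longrightarrow> r < length (shape T) \<Longrightarrow> Vertical r \<in> set (partition_path T)"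
  by (simp add: set_partition_path)

lemma Horizontal_in_path: "built T \<Longrightarrow> c < width T \<Longrightarrow> Horizontal c \<in> set (partition_path T)"
  by (simp add: set_partition_path)

lemma row_label_add_column:
  assumes "built T" "R \<subseteq> unrestricted_rows T" "R \<noteq> {}" "r < length (shape T)"
  shows "row_label (add_column R T) r = row_label T r"
  using label_of_add_column(1)[OF assms(1-3) Vertical_in_path[OF assms(1,4)]] by simp

text \<open>A new row is the lowest and receives the last label. This monotonicity translates the
  order of rows into the order of positions used by the insertion cycle.\<close>

lemma row_label_less:
  "built T \<Longrightarrow> r < r' \<Longrightarrow> r' < length (shape T) \<Longrightarrow> row_label T r < row_label T r'"
proof (induction arbitrary: r r' rule: built.induct)
  case (row T)
  have r: "row_label (add_row T) r = row_label T r" "row_label T r \<le> length (partition_path T)"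
    using row label_of_add_row(1) label_of_in_path(1) Vertical_in_path by auto
  show ?case
  proof (cases "r' = length (shape T)")
    case True
    then show ?thesis using r label_of_add_row(2)[OF row(1)] by simp
  next
    case False
    then have "r' < length (shape T)" using row by simp
    then show ?thesis using row r label_of_add_row(1) Vertical_in_path by simp
  qed
next
  case (column T R)
  then show ?case by (simp add: row_label_add_column)
qed simp

lemma row_label_less_iff:
  assumes "built T" "r < length (shape T)" "r' < length (shape T)"
  shows "row_label T r < row_label T r' \<longleftrightarrow> r < r'"
  using row_label_less[OF assms(1), of r r'] row_label_less[OF assms(1), of r' r] assms
  by (cases r r' rule: linorder_cases) auto

lemma inj_on_row_label:
  assumes "built T"
  shows "inj_on (row_label T) {..<length (shape T)}"
proof (rule inj_onI)
  fix r r' assume "r \<in> {..<length (shape T)}" "r' \<in> {..<length (shape T)}" "row_label T r = row_label T r'"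
  then show "r = r'"
    using row_label_less_iff[OF assms, of r r'] row_label_less_iff[OF assms, of r' r] by simp
qed

section \<open>How the zigzag paths change\<close>

lemma vertices_subset:
  assumes "built T"
  shows "vertices T \<subseteq> {..<length (shape T)} \<times> {..<width T}"
proof (rule subrelI)
  fix r c assume "(r, c) \<in> vertices T"
  then have rc: "r < length (shape T)" "c < shape T ! r"
    by (auto simp: vertices_def young_diagram_def)
  have "\<forall>x \<in> set (shape T). x \<le> width T"
    using built_imp_permutation_tableau[OF assms] unfolding in_permutation_tableaux_iff by blast
  then have "shape T ! r \<le> width T" using rc(1) by simp
  then show "(r, c) \<in> {..<length (shape T)} \<times> {..<width T}" using rc by simp
qed

lemma vertices_add_row: "vertices (add_row T) = vertices T"
  by (simp add: vertices_def young_diagram_append_0)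

lemma vertices_add_column:
  assumes "R \<subseteq> {..<length (shape T)}"
  shows "(r, 0) \<in> vertices (add_column R T) \<longleftrightarrow> r \<in> R"
    "(r, Suc c) \<in> vertices (add_column R T) \<longleftrightarrow> (r, c) \<in> vertices T"
proof -
  show "(r, 0) \<in> vertices (add_column R T) \<longleftrightarrow> r \<in> R"
    using assms by (cases "r < length (shape T)") (auto simp: vertices_def young_diagram_map_Suc)
  show "(r, Suc c) \<in> vertices (add_column R T) \<longleftrightarrow> (r, c) \<in> vertices T"
    by (simp add: vertices_def young_diagram_map_Suc)
qed

lemma column_has_vertex:
  assumes "built T" "c < width T"
  shows "\<exists>r. (r, c) \<in> vertices T"
  using built_imp_permutation_tableau[OF assms(1)] assms(2)
  unfolding vertices_def in_permutation_tableaux_iff by blast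

text \<open>\<open>row_exit\<close> and \<open>column_exit\<close> restate the two branches of
  \<open>\<Phi>\<close> by row and column index instead of label, since the zigzag paths are
  compared by boxes.\<close>

definition row_exit :: "tableau \<Rightarrow> nat \<Rightarrow> nat" where
  "row_exit T r =
     (if \<exists>c. (r, c) \<in> vertices T then travel T South (r, LEAST c. (r, c) \<in> vertices T)
      else row_label T r)"

definition column_exit :: "tableau \<Rightarrow> nat \<Rightarrow> nat" where
  "column_exit T c = travel T East (LEAST r. (r, c) \<in> vertices T, c)"

lemma \<Phi>_row_label:
  assumes "built T" "r < length (shape T)"
  shows "\<Phi> T (row_label T r) = row_exit T r"
  using label_of_in_path[OF assms(1) Vertical_in_path[OF assms]]
  by (simp add: \<Phi>_def row_exit_def)

lemma \<Phi>_column_label: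
  assumes "built T" "c < width T"
  shows "\<Phi> T (label_of T (Horizontal c)) = column_exit T c"
  using label_of_in_path[OF assms(1) Horizontal_in_path[OF assms]]
  by (simp add: \<Phi>_def column_exit_def)

lemma \<Phi>_outside: "i \<notin> {1..length (partition_path T)} \<Longrightarrow> \<Phi> T i = i"
  unfolding \<Phi>_def by (rule if_not_P)

lemma Least_shift:
  fixes P Q :: "nat \<Rightarrow> bool"
  assumes "\<exists>c. P c" "\<And>c. Q (c + e) \<longleftrightarrow> P c" "\<And>c. Q c \<Longrightarrow> e \<le> c"
  shows "(LEAST c. Q c) = (LEAST c. P c) + e"
proof (rule Least_equality)
  show "Q ((LEAST c. P c) + e)" using assms LeastI_ex by blast
  fix c assume "Q c"
  then have "e \<le> c" "P (c - e)" using assms(2)[of "c - e"] assms(3) by auto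
  then show "(LEAST c. P c) + e \<le> c" using Least_le[of P "c - e"] by linarith
qed

lemma travel_Vertex: "edge T d v = Vertex w \<Longrightarrow> travel T d v = travel T (turn d) w"
  by (subst travel.simps) simp

lemma travel_Label: "edge T d v = Label j \<Longrightarrow> travel T d v = j"
  by (subst travel.simps) simp

text \<open>Paths go only south and east, so they never meet the columns to the left of index
  \<open>e\<close>, and the rest is a faithful copy of \<open>T\<close>. The distance to the
  southeast corner drops with each move. An empty row uses \<open>e = 0\<close>, a new column
  \<open>e = 1\<close>.\<close>

lemma travel_shift:
  assumes sub: "vertices T \<subseteq> {..<k} \<times> {..<m}"
    and vertices: "\<And>r c. (r, c + e) \<in> vertices T' \<longleftrightarrow> (r, c) \<in> vertices T"
    and rows: "\<And>r. r < k \<Longrightarrow> label_of T' (Vertical r) = label_of T (Vertical r)"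
    and columns: "\<And>c. c < m \<Longrightarrow> label_of T' (Horizontal (c + e)) = label_of T (Horizontal c)"
  shows "(r, c) \<in> vertices T \<Longrightarrow> travel T' d (r, c + e) = travel T d (r, c)"
proof (induction "(k - r) + (m - c)" arbitrary: r c d rule: less_induct)
  case less
  have rc: "r < k" "c < m" using less.prems sub by auto
  show ?case
  proof (cases d)
    case East
    show ?thesis
    proof (cases "\<exists>c' > c. (r, c') \<in> vertices T")
      case True
      define c1 where "c1 = (LEAST c'. c' > c \<and> (r, c') \<in> vertices T)"
      have c1: "c1 > c" "(r, c1) \<in> vertices T"
        using LeastI_ex[OF True] by (auto simp: c1_def)
      then have "c1 < m" using sub by auto
      have "(LEAST c'. c' > c + e \<and> (r, c') \<in> vertices T') = c1 + e"
        unfolding c1_def by (rule Least_shift[OF True]) (use vertices in auto)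
      moreover have "\<exists>c' > c + e. (r, c') \<in> vertices T'"
        using c1 vertices by (intro exI[of _ "c1 + e"]) auto
      ultimately have "edge T' d (r, c + e) = Vertex (r, c1 + e)" using East by simp
      moreover have "edge T d (r, c) = Vertex (r, c1)" using East True by (simp add: c1_def)
      moreover have "travel T' (turn d) (r, c1 + e) = travel T (turn d) (r, c1)"
        using c1 \<open>c1 < m\<close> by (intro less.hyps) auto
      ultimately show ?thesis by (simp only: travel_Vertex)
    next
      case False
      have "\<not> (\<exists>c' > c + e. (r, c') \<in> vertices T')"
      proof
        assume "\<exists>c' > c + e. (r, c') \<in> vertices T'"
        then obtain c' where "c' > c + e" "(r, c') \<in> vertices T'" by blast
        then show False using False vertices[of r "c' - e"] by auto
      qed
      then have "edge T' d (r, c + e) = Label (row_label T r)" "edge T d (r, c) = Label (row_label T r)"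
        using East False rows[OF rc(1)] by simp_all
      then show ?thesis by (simp only: travel_Label)
    qed
  next
    case South
    show ?thesis
    proof (cases "\<exists>r' > r. (r', c) \<in> vertices T")
      case True
      define r1 where "r1 = (LEAST r'. r' > r \<and> (r', c) \<in> vertices T)"
      have r1: "r1 > r" "(r1, c) \<in> vertices T"
        using LeastI_ex[OF True] by (auto simp: r1_def)
      then have "r1 < k" using sub by auto
      have "edge T' d (r, c + e) = Vertex (r1, c + e)" "edge T d (r, c) = Vertex (r1, c)"
        using South True vertices by (simp_all add: r1_def)
      moreover have "travel T' (turn d) (r1, c + e) = travel T (turn d) (r1, c)"
        using r1 \<open>r1 < k\<close> by (intro less.hyps) auto
      ultimately show ?thesis by (simp only: travel_Vertex)
    next
      case False
      then have "edge T' d (r, c + e) = Label (label_of T (Horizontal c))"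
        "edge T d (r, c) = Label (label_of T (Horizontal c))"
        using South vertices columns[OF rc(2)] by simp_all
      then show ?thesis by (simp only: travel_Label)
    qed
  qed
qed

text \<open>Vertices and old labels are unchanged. The new label is fixed on both sides: as the
  label of an empty row, and by the default value of \<open>\<Phi> T\<close> outside its
  labels.\<close>

lemma \<Phi>_add_row:
  assumes T: "built T"
  shows "\<Phi> (add_row T) = \<Phi> T"
proof
  fix i
  let ?n = "length (partition_path T)"
  note built' = built.row[OF T]
  have travel: "travel (add_row T) d (r, c) = travel T d (r, c)" if "(r, c) \<in> vertices T" for d r c
    using travel_shift[OF vertices_subset[OF T], of 0 "add_row T"] that
    by (simp add: vertices_add_row label_of_add_row(1)[OF T] Vertical_in_path[OF T] Horizontal_in_path[OF T])
  consider (old) "i \<in> {1..?n}" | (new) "i = Suc ?n" | (outside) "i \<notin> {1..Suc ?n}" by fastforce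
  then show "\<Phi> (add_row T) i = \<Phi> T i"
  proof cases
    case old
    then obtain s where s: "s \<in> set (partition_path T)" "i = label_of T s" using ex_label[OF T] by blast
    then have i: "i = label_of (add_row T) s" using label_of_add_row(1)[OF T] by simp
    show ?thesis
    proof (cases s)
      case (Vertical r)
      then have r: "r < length (shape T)" using s set_partition_path[OF T] by auto
      have "row_exit (add_row T) r = row_exit T r"
        using label_of_add_row(1)[OF T] s Vertical
        by (auto simp: row_exit_def vertices_add_row intro!: travel intro: LeastI)
      then show ?thesis
        using \<Phi>_row_label[OF T r] \<Phi>_row_label[OF built', of r] r i s Vertical by simp
    next
      case (Horizontal c)
      then have c: "c < width T" using s set_partition_path[OF T] by auto
      have "column_exit (add_row T) c = column_exit T c"
        unfolding column_exit_def vertices_add_row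
        by (rule travel, rule LeastI_ex[OF column_has_vertex[OF T c]])
      then show ?thesis
        using \<Phi>_column_label[OF T c] \<Phi>_column_label[OF built', of c] c i s Horizontal by simp
    qed
  next
    case new
    have "row_exit (add_row T) (length (shape T)) = Suc ?n"
      using vertices_subset[OF T] label_of_add_row(2)[OF T] by (auto simp: row_exit_def vertices_add_row)
    then show ?thesis
      using \<Phi>_row_label[OF built', of "length (shape T)"] new label_of_add_row(2)[OF T] \<Phi>_outside[of i T]
      by simp
  next
    case outside
    then show ?thesis using \<Phi>_outside[of i T] \<Phi>_outside[of i "add_row T"] by auto
  qed
qed

section \<open>Effect of a new leftmost column\<close>

context
  fixes T R
  assumes T: "built T" and R: "R \<subseteq> unrestricted_rows T" "R \<noteq> {}"
begin

lemma R_less: "r \<in> R \<Longrightarrow> r < length (shape T)"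
  using R unrestricted_rows_less by blast

lemma vertices_new:
  "(r, 0) \<in> vertices (add_column R T) \<longleftrightarrow> r \<in> R"
  "(r, Suc c) \<in> vertices (add_column R T) \<longleftrightarrow> (r, c) \<in> vertices T"
  using vertices_add_column[of R T] R_less by auto

lemma travel_add_column:
  assumes "(r, c) \<in> vertices T"
  shows "travel (add_column R T) d (r, Suc c) = travel T d (r, c)"
proof -
  have "travel (add_column R T) d (r, c + 1) = travel T d (r, c)"
  proof (rule travel_shift[OF vertices_subset[OF T]])
    show "label_of (add_column R T) (Horizontal (c + 1)) = label_of T (Horizontal c)" if "c < width T" for c
      using label_of_add_column(1)[OF T R Horizontal_in_path[OF T that]] by simp
  qed (use vertices_new row_label_add_column[OF T R] assms in simp_all)
  then show ?thesis by simp
qed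

lemma Least_column_Suc:
  assumes "\<exists>c. (r, c) \<in> vertices T"
  shows "(LEAST c. 0 < c \<and> (r, c) \<in> vertices (add_column R T)) = Suc (LEAST c. (r, c) \<in> vertices T)"
proof -
  have "(LEAST c. 0 < c \<and> (r, c) \<in> vertices (add_column R T)) = (LEAST c. (r, c) \<in> vertices T) + 1"
    by (rule Least_shift[OF assms]) (use vertices_new in auto)
  then show ?thesis by simp
qed

text \<open>Going east from the new column, the path meets the leftmost old vertex of the row and
  turns south, which is how the path of that row starts in \<open>T\<close>; in a row without old
  vertices it ends at the row label.\<close>

lemma travel_East_new_column:
  assumes r: "r < length (shape T)"
  shows "travel (add_column R T) East (r, 0) = row_exit T r"
proof (cases "\<exists>c. (r, c) \<in> vertices T")
  case True
  then have "\<exists>c > 0. (r, c) \<in> vertices (add_column R T)" using vertices_new by blast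
  then have "edge (add_column R T) East (r, 0) = Vertex (r, Suc (LEAST c. (r, c) \<in> vertices T))"
    using Least_column_Suc[OF True] by simp
  then have "travel (add_column R T) East (r, 0) =
      travel (add_column R T) South (r, Suc (LEAST c. (r, c) \<in> vertices T))"
    by (simp add: travel_Vertex)
  also have "\<dots> = travel T South (r, LEAST c. (r, c) \<in> vertices T)"
    by (rule travel_add_column) (rule LeastI_ex[OF True])
  finally show ?thesis using True by (simp add: row_exit_def)
next
  case False
  then have "\<not> (\<exists>c > 0. (r, c) \<in> vertices (add_column R T))"
    using vertices_new by (metis not0_implies_Suc less_irrefl)
  then have "edge (add_column R T) East (r, 0) = Label (row_label T r)"
    using row_label_add_column[OF T R r] by simp
  then show ?thesis using False by (simp add: travel_Label row_exit_def)
qed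

lemma row_exit_add_column:
  assumes r: "r < length (shape T)" "r \<notin> R"
  shows "row_exit (add_column R T) r = row_exit T r"
proof (cases "\<exists>c. (r, c) \<in> vertices T")
  case True
  have "(0 < c \<and> (r, c) \<in> vertices (add_column R T)) = ((r, c) \<in> vertices (add_column R T))" for c
    using r vertices_new(1)[of r] by (cases "c = 0") auto
  then have "(LEAST c. (r, c) \<in> vertices (add_column R T)) = Suc (LEAST c. (r, c) \<in> vertices T)"
    using Least_column_Suc[OF True] by simp
  moreover have "\<exists>c. (r, c) \<in> vertices (add_column R T)" using True vertices_new(2) by blast
  ultimately have "row_exit (add_column R T) r =
      travel (add_column R T) South (r, Suc (LEAST c. (r, c) \<in> vertices T))"
    by (simp add: row_exit_def)
  also have "\<dots> = travel T South (r, LEAST c. (r, c) \<in> vertices T)"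
    by (rule travel_add_column) (rule LeastI_ex[OF True])
  finally show ?thesis using True by (simp add: row_exit_def)
next
  case False
  have "(r, c) \<notin> vertices (add_column R T)" for c
    using False r vertices_new by (cases c) auto
  then show ?thesis using False row_label_add_column[OF T R r(1)] by (simp add: row_exit_def)
qed

text \<open>The leftmost vertex of the row is now the one in the new column. The path drops to the
  next vertex there, turns east and continues as the old path of that row; from the lowest vertex it
  leaves through the bottom of the new column.\<close>

lemma row_exit_add_column_new:
  assumes r: "r \<in> R"
  shows "row_exit (add_column R T) r =
    (if \<exists>r' \<in> R. r < r' then row_exit T (LEAST r'. r' > r \<and> r' \<in> R)
     else Suc (length (partition_path T)))"
proof -
  have "(LEAST c. (r, c) \<in> vertices (add_column R T)) = 0"
    using r vertices_new by (intro Least_equality) auto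
  moreover have "\<exists>c. (r, c) \<in> vertices (add_column R T)" using r vertices_new(1) by blast
  ultimately have 1: "row_exit (add_column R T) r = travel (add_column R T) South (r, 0)"
    by (simp add: row_exit_def)
  show ?thesis
  proof (cases "\<exists>r' \<in> R. r < r'")
    case True
    define r1 where "r1 = (LEAST r'. r' > r \<and> r' \<in> R)"
    have "\<exists>r'. r' > r \<and> r' \<in> R" using True by blast
    then have "r1 \<in> R" using LeastI_ex[of "\<lambda>r'. r' > r \<and> r' \<in> R"] by (simp add: r1_def)
    have "\<exists>r' > r. (r', 0) \<in> vertices (add_column R T)" using True vertices_new by blast
    then have "edge (add_column R T) South (r, 0) = Vertex (r1, 0)"
      by (simp add: r1_def vertices_new)
    then have "row_exit (add_column R T) r = travel (add_column R T) East (r1, 0)"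
      using 1 by (simp add: travel_Vertex)
    then show ?thesis
      using True travel_East_new_column[OF R_less[OF \<open>r1 \<in> R\<close>]] by (simp add: r1_def)
  next
    case False
    then have "edge (add_column R T) South (r, 0) = Label (Suc (length (partition_path T)))"
      using label_of_add_column(2)[OF T R] by (auto simp: vertices_new)
    then show ?thesis using 1 False by (auto simp: travel_Label)
  qed
qed

lemma column_exit_add_column:
  assumes c: "c < width T"
  shows "column_exit (add_column R T) (Suc c) = column_exit T c"
  unfolding column_exit_def vertices_new
  by (rule travel_add_column, rule LeastI_ex[OF column_has_vertex[OF T c]])

lemma column_exit_add_column_new: "column_exit (add_column R T) 0 = row_exit T (LEAST r. r \<in> R)"
proof -
  have "(LEAST r. r \<in> R) \<in> R" using R(2) by (metis LeastI ex_in_conv)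
  then show ?thesis
    unfolding column_exit_def vertices_new by (intro travel_East_new_column R_less)
qed

lemma row_label_image_bounds: "row_label T ` R \<subseteq> {1..length (partition_path T)}"
  using label_of_in_path(1)[OF T Vertical_in_path[OF T R_less]] by blast

lemma Min_row_label: "Min (row_label T ` R) = row_label T (LEAST r. r \<in> R)"
proof (rule Min_eqI)
  show "finite (row_label T ` R)" using row_label_image_bounds finite_subset by blast
  have least: "(LEAST r. r \<in> R) \<in> R" using R(2) by (metis LeastI ex_in_conv)
  then show "row_label T (LEAST r. r \<in> R) \<in> row_label T ` R" by blast
  fix l assume "l \<in> row_label T ` R"
  then obtain r where r: "r \<in> R" "l = row_label T r" by blast
  then have "\<not> r < (LEAST r. r \<in> R)" using not_less_Least by blast
  then show "row_label T (LEAST r. r \<in> R) \<le> l"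
    using row_label_less_iff[OF T, of r "LEAST r. r \<in> R"] R_less r least by simp
qed

text \<open>Labels increase with rows, so the next label in the image of \<open>R\<close> belongs to
  the next row of \<open>R\<close>; after the last row comes the label of the new column.\<close>

lemma insertion_cycle_row_label:
  assumes r: "r \<in> R"
  shows "insertion_cycle (Suc (length (partition_path T))) (row_label T ` R) (row_label T r) =
    (if \<exists>r' \<in> R. r < r' then row_label T (LEAST r'. r' > r \<and> r' \<in> R)
     else Suc (length (partition_path T)))"
proof -
  let ?N = "Suc (length (partition_path T))"
  have bound: "row_label T r' < ?N" if "r' \<in> R" for r'
    using row_label_image_bounds that by (simp add: image_subset_iff less_Suc_eq_le)
  have less_iff: "row_label T r' < row_label T r'' \<longleftrightarrow> r' < r''" if "r' \<in> R" "r'' \<in> R" for r' r''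
    using row_label_less_iff[OF T] R_less that by simp
  have eq: "insertion_cycle ?N (row_label T ` R) (row_label T r) =
      (LEAST j. j \<in> insert ?N (row_label T ` R) \<and> row_label T r < j)"
    using r bound[OF r] by (simp add: insertion_cycle_def)
  show ?thesis
  proof (cases "\<exists>r' \<in> R. r < r'")
    case True
    define r1 where "r1 = (LEAST r'. r' > r \<and> r' \<in> R)"
    have "\<exists>r'. r' > r \<and> r' \<in> R" using True by blast
    then have r1: "r < r1" "r1 \<in> R"
      using LeastI_ex[of "\<lambda>r'. r' > r \<and> r' \<in> R"] by (simp_all add: r1_def)
    have "(LEAST j. j \<in> insert ?N (row_label T ` R) \<and> row_label T r < j) = row_label T r1"
    proof (rule Least_equality)
      show "row_label T r1 \<in> insert ?N (row_label T ` R) \<and> row_label T r < row_label T r1"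
        using r r1 less_iff by blast
      fix j assume j: "j \<in> insert ?N (row_label T ` R) \<and> row_label T r < j"
      show "row_label T r1 \<le> j"
      proof (cases "j = ?N")
        case True
        then show ?thesis using bound[OF r1(2)] by simp
      next
        case False
        then obtain r' where r': "r' \<in> R" "j = row_label T r'" using j by blast
        then have "r < r'" using j less_iff r by blast
        then have "r1 \<le> r'" using r' by (simp add: r1_def Least_le)
        then show ?thesis using r' r1 less_iff[of r' r1] by simp
      qed
    qed
    then show ?thesis using eq True by (simp add: r1_def)
  next
    case False
    have "(LEAST j. j \<in> insert ?N (row_label T ` R) \<and> row_label T r < j) = ?N"
      using False bound r less_iff by (intro Least_equality) auto
    then show ?thesis using eq False by simp
  qed
qed

text \<open>Each row of \<open>R\<close> takes over the old path of the next row of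
  \<open>R\<close>, and the new column that of the first. The lowest row of \<open>R\<close> is sent
  by the cycle to the new label, where the assumption \<open>new\<close> makes
  \<open>\<Phi> T\<close> the identity.\<close>

lemma \<Phi>_add_column:
  assumes new: "\<Phi> T (Suc (length (partition_path T))) = Suc (length (partition_path T))"
  shows "\<Phi> (add_column R T) =
    \<Phi> T \<circ> insertion_cycle (Suc (length (partition_path T))) (row_label T ` R)"
proof
  fix i
  let ?n = "length (partition_path T)" and ?L = "row_label T ` R"
  let ?c = "insertion_cycle (Suc ?n) ?L"
  note built' = built.column[OF T R]
  note \<Phi>_row = \<Phi>_row_label[OF T]
  have least: "(LEAST r. r \<in> R) \<in> R" using R(2) by (metis LeastI ex_in_conv)
  consider (old) "i \<in> {1..?n}" | (new) "i = Suc ?n" | (outside) "i \<notin> {1..Suc ?n}" by fastforce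
  then show "\<Phi> (add_column R T) i = (\<Phi> T \<circ> ?c) i"
  proof cases
    case old
    then obtain s where s: "s \<in> set (partition_path T)" "i = label_of T s" using ex_label[OF T] by blast
    then have i: "i = label_of (add_column R T) (shift_step s)"
      using label_of_add_column(1)[OF T R] by simp
    show ?thesis
    proof (cases s)
      case (Vertical r)
      then have r: "r < length (shape T)" using s set_partition_path[OF T] by auto
      have 1: "\<Phi> (add_column R T) i = row_exit (add_column R T) r"
        using \<Phi>_row_label[OF built', of r] r i Vertical by simp
      show ?thesis
      proof (cases "r \<in> R")
        case True
        show ?thesis
        proof (cases "\<exists>r' \<in> R. r < r'")
          case ex: True
          then have "\<exists>r'. r' > r \<and> r' \<in> R" by blast
          then have "(LEAST r'. r' > r \<and> r' \<in> R) \<in> R"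
            using LeastI_ex[of "\<lambda>r'. r' > r \<and> r' \<in> R"] by simp
          then show ?thesis
            using 1 ex row_exit_add_column_new[OF True] insertion_cycle_row_label[OF True]
              \<Phi>_row[OF R_less] s Vertical by simp
        next
          case False
          then show ?thesis
            using 1 row_exit_add_column_new[OF True] insertion_cycle_row_label[OF True]
              new s Vertical by simp
        qed
      next
        case False
        have "i \<notin> ?L"
          using False r s Vertical R_less inj_on_row_label[OF T] by (auto dest: inj_onD)
        then have "?c i = i" using old by (simp add: insertion_cycle_def)
        then show ?thesis using 1 row_exit_add_column[OF r False] \<Phi>_row[OF r] s Vertical by simp
      qed
    next
      case (Horizontal c)
      then have c: "c < width T" using s set_partition_path[OF T] by auto
      have "i \<notin> ?L"
      proof
        assume "i \<in> ?L"
        then obtain r where "r \<in> R" "i = row_label T r" by blast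
        then have "partition_path T ! (i - 1) = Vertical r"
          using label_of_in_path(2)[OF T Vertical_in_path[OF T R_less]] by simp
        then show False using label_of_in_path(2)[OF T s(1)] s Horizontal by simp
      qed
      then have "?c i = i" using old by (simp add: insertion_cycle_def)
      then show ?thesis
        using \<Phi>_column_label[OF T c] \<Phi>_column_label[OF built', of "Suc c"] c i s Horizontal
          column_exit_add_column[OF c] by simp
    qed
  next
    case new
    have "\<Phi> (add_column R T) i = column_exit (add_column R T) 0"
      using \<Phi>_column_label[OF built', of 0] new label_of_add_column(2)[OF T R] by simp
    moreover have "?c i = row_label T (LEAST r. r \<in> R)"
      using new Min_row_label by (simp add: insertion_cycle_def)
    ultimately show ?thesis
      using column_exit_add_column_new \<Phi>_row[OF R_less[OF least]] by simp
  next
    case outside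
    then have "i \<notin> ?L" "i \<noteq> Suc ?n" using row_label_image_bounds by auto
    then have "?c i = i" by (simp add: insertion_cycle_def)
    then show ?thesis using outside \<Phi>_outside[of i T] \<Phi>_outside[of i "add_column R T"] by auto
  qed
qed

end

section \<open>The bijection\<close>

lemma row_labels_insertion:
  assumes "built T" "R \<subseteq> unrestricted_rows T" "R \<noteq> {}"
  shows "insertion (length (partition_path T)) (row_label T ` R)"
  using row_label_image_bounds[OF assms] assms(3) by unfold_locales auto

lemma \<Phi>_new_label: "\<Phi> T (Suc (length (partition_path T))) = Suc (length (partition_path T))"
  by (rule \<Phi>_outside) simp

text \<open>The claims are proved together because the insertion lemmas require a permutation and a
  set of its left-to-right maxima. The second claim persists since
  \<open>unrestricted_rows_add_column\<close> and \<open>inserted_lr_maxima\<close> are the same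
  recursion.\<close>

lemma \<Phi>_invariants:
  "built T \<Longrightarrow> \<Phi> T permutes {1..length (partition_path T)} \<and>
     row_label T ` unrestricted_rows T = lr_maxima (length (partition_path T)) (\<Phi> T) \<and>
     weak_excedances (length (partition_path T)) (\<Phi> T) = row_label T ` {..<length (shape T)}"
proof (induction rule: built.induct)
  case empty
  have "\<Phi> empty_tableau = id" using \<Phi>_outside[of _ empty_tableau] by (auto simp: fun_eq_iff)
  then show ?case
    by (auto simp: permutes_id unrestricted_rows_def lr_maxima_def weak_excedances_def)
next
  case (row T)
  let ?n = "length (partition_path T)"
  have old: "row_label (add_row T) ` A = row_label T ` A" if "A \<subseteq> {..<length (shape T)}" for A
    using that label_of_add_row(1)[OF row.hyps] Vertical_in_path[OF row.hyps]
    by (intro image_cong) auto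
  have "unrestricted_rows T \<subseteq> {..<length (shape T)}" using unrestricted_rows_less by blast
  then have "row_label (add_row T) ` unrestricted_rows (add_row T) = lr_maxima (Suc ?n) (\<Phi> (add_row T))"
    using row.IH old label_of_add_row(2)[OF row.hyps]
    by (simp add: unrestricted_rows_add_row \<Phi>_add_row[OF row.hyps] lr_maxima_Suc_fixed)
  moreover have "\<Phi> T permutes {1..Suc ?n}" using row.IH permutes_subset[of "\<Phi> T" "{1..?n}"] by simp
  moreover have "weak_excedances (Suc ?n) (\<Phi> T) = insert (Suc ?n) (weak_excedances ?n (\<Phi> T))"
    using \<Phi>_new_label[of T] by (auto simp: weak_excedances_def le_Suc_eq)
  ultimately show ?case
    using row.IH old[OF subset_refl] label_of_add_row(2)[OF row.hyps]
    by (simp add: \<Phi>_add_row[OF row.hyps] lessThan_Suc)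
next
  case (column T R)
  let ?n = "length (partition_path T)" and ?L = "row_label T ` R"
  note hyps = column.hyps
  interpret insertion ?n ?L by (rule row_labels_insertion[OF hyps])
  have perm: "\<Phi> T permutes {1..?n}" using column.IH by blast
  have lr: "?L \<subseteq> lr_maxima ?n (\<Phi> T)" using column.IH hyps(2) by blast
  have eq: "\<Phi> (add_column R T) = \<Phi> T \<circ> insertion_cycle (Suc ?n) ?L"
    using \<Phi>_add_column[OF hyps \<Phi>_new_label] .
  have len: "length (partition_path (add_column R T)) = Suc ?n" by simp
  have old: "row_label (add_column R T) ` A = row_label T ` A" if "A \<subseteq> {..<length (shape T)}" for A
    using that row_label_add_column[OF hyps] by (intro image_cong) auto
  have unr: "r < length (shape T)" if "r \<in> unrestricted_rows T" for r
    using unrestricted_rows_less that by blast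
  have "row_label (add_column R T) ` unrestricted_rows (add_column R T) =
      row_label T ` {r \<in> unrestricted_rows T. r \<in> R \<or> (\<forall>r' \<in> R. r < r')}"
    unfolding unrestricted_rows_add_column[OF hyps(2)] by (rule old) (use unr in auto)
  \<comment> \<open>Row labels are injective and increasing, so membership in \<open>R\<close> and
    lying above all of \<open>R\<close> carry over to labels.\<close>
  also have "\<dots> = {i \<in> row_label T ` unrestricted_rows T. i \<in> ?L \<or> (\<forall>j \<in> ?L. i < j)}"
  proof -
    have "row_label T r \<in> ?L \<longleftrightarrow> r \<in> R" if "r \<in> unrestricted_rows T" for r
      using inj_on_image_mem_iff[OF inj_on_row_label[OF hyps(1)], of r R] that unr hyps(2) by auto
    moreover have "(\<forall>j \<in> ?L. row_label T r < j) \<longleftrightarrow> (\<forall>r' \<in> R. r < r')"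
      if "r \<in> unrestricted_rows T" for r
      using row_label_less_iff[OF hyps(1)] unr that hyps(2) by (simp add: subset_iff)
    ultimately show ?thesis by auto
  qed
  also have "\<dots> = lr_maxima (Suc ?n) (\<Phi> (add_column R T))"
    unfolding eq inserted_lr_maxima[OF perm lr] using column.IH by simp
  finally have "row_label (add_column R T) ` unrestricted_rows (add_column R T) =
      lr_maxima (Suc ?n) (\<Phi> (add_column R T))" .
  moreover have "weak_excedances (Suc ?n) (\<Phi> (add_column R T)) =
      row_label (add_column R T) ` {..<length (shape (add_column R T))}"
    unfolding eq inserted_weak_excedances[OF perm lr] using column.IH old by simp
  moreover have "\<Phi> (add_column R T) permutes {1..Suc ?n}"
    unfolding eq by (rule inserted_permutes[OF perm lr])
  ultimately show ?case unfolding len by blast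
qed

lemmas \<Phi>_permutes = \<Phi>_invariants[THEN conjunct1]
  and \<Phi>_lr_maxima = \<Phi>_invariants[THEN conjunct2, THEN conjunct1]
  and \<Phi>_weak_excedances = \<Phi>_invariants[THEN conjunct2, THEN conjunct2]

lemma card_weak_excedances_\<Phi>:
  assumes "built T"
  shows "card (weak_excedances (length (partition_path T)) (\<Phi> T)) = length (shape T)"
  using \<Phi>_weak_excedances[OF assms] inj_on_row_label[OF assms] by (simp add: card_image)

text \<open>What is needed to undo a column: \<open>q\<close> alone determines the labels of
  \<open>R\<close>, and moving \<open>Suc n\<close> tells a column from a row.\<close>

lemma \<Phi>_add_column_insertion:
  assumes "built T" "R \<subseteq> unrestricted_rows T" "R \<noteq> {}"
  defines "n \<equiv> length (partition_path T)" and "q \<equiv> \<Phi> (add_column R T)"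
  shows "q = \<Phi> T \<circ> insertion_cycle (Suc n) (row_label T ` R)"
    and "row_label T ` R = {i \<in> lr_maxima (Suc n) q. q (Suc n) < q i}"
    and "q (Suc n) \<noteq> Suc n"
    and "insertion_cycle (Suc n) (row_label T ` R) permutes {1..Suc n}"
proof -
  interpret insertion n "row_label T ` R"
    unfolding n_def by (rule row_labels_insertion[OF assms(1-3)])
  have perm: "\<Phi> T permutes {1..n}" using \<Phi>_permutes[OF assms(1)] by (simp add: n_def)
  have lr: "row_label T ` R \<subseteq> lr_maxima n (\<Phi> T)"
    using \<Phi>_lr_maxima[OF assms(1)] assms(2) by (auto simp: n_def)
  show eq: "q = \<Phi> T \<circ> insertion_cycle (Suc n) (row_label T ` R)"
    using \<Phi>_add_column[OF assms(1-3) \<Phi>_new_label] by (simp add: n_def q_def)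
  show "row_label T ` R = {i \<in> lr_maxima (Suc n) q. q (Suc n) < q i}"
    using inserted_recover_L[OF perm lr] unfolding eq .
  show "q (Suc n) \<noteq> Suc n"
    using inserted_N(2)[OF perm lr] unfolding eq by simp
  show "insertion_cycle (Suc n) (row_label T ` R) permutes {1..Suc n}"
    by (rule cycle_permutes)
qed

text \<open>Whether the last label is fixed decides the last border step of both tableaux. For a
  column, the labels of \<open>R\<close> are read off and the common cycle is cancelled; induction
  identifies the smaller tableaux, and then injectivity of the row labels identifies
  \<open>R\<close>.\<close>

lemma \<Phi>_inj:
  assumes "built T1" "built T2" "length (partition_path T1) = length (partition_path T2)" "\<Phi> T1 = \<Phi> T2"
  shows "T1 = T2"
  using assms
proof (induction arbitrary: T2 rule: built.induct)
  case empty
  from empty.prems show ?case by (cases rule: built.cases) auto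
next
  case (row T)
  let ?n = "length (partition_path T)"
  have fixed: "\<Phi> T2 (Suc ?n) = Suc ?n"
    using row.prems(3) \<Phi>_add_row[OF row.hyps] \<Phi>_new_label[of T] by simp
  from row.prems(1) show ?case
  proof (cases rule: built.cases)
    case empty
    then show ?thesis using row.prems by simp
  next
    case (row T')
    then show ?thesis
      using row.prems(2,3) row.IH[of T'] \<Phi>_add_row[of T'] \<Phi>_add_row[OF row.hyps] by simp
  next
    case (column T' R')
    then show ?thesis
      using \<Phi>_add_column_insertion(3)[OF column(2-4)] fixed row.prems(2) by simp
  qed
next
  case (column T R)
  let ?n = "length (partition_path T)"
  note ins = \<Phi>_add_column_insertion[OF column.hyps]
  from column.prems(1) show ?case
  proof (cases rule: built.cases)
    case empty
    then show ?thesis using column.prems by simp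
  next
    case (row T')
    then have "\<Phi> T2 (Suc ?n) = Suc ?n"
      using \<Phi>_add_row[of T'] \<Phi>_new_label[of T'] column.prems(2) by simp
    then show ?thesis using ins(3) column.prems(3) by simp
  next
    case (column T' R')
    note ins' = \<Phi>_add_column_insertion[OF column(2-4)]
    have n: "length (partition_path T') = ?n" using column(1) column.prems(2) by simp
    have L: "row_label T' ` R' = row_label T ` R"
      using ins(2) ins'(2) column.prems(3) column(1) n by simp
    have "\<Phi> T \<circ> insertion_cycle (Suc ?n) (row_label T ` R) =
        \<Phi> T' \<circ> insertion_cycle (Suc ?n) (row_label T ` R)"
      using ins(1) ins'(1)[unfolded n L] column.prems(3) column(1) by metis
    then have "\<Phi> T = \<Phi> T'"
      using permutes_surj[OF ins(4)] by (metis fun.map_comp surj_iff comp_assoc comp_id)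
    then have TT': "T = T'" using column.IH[OF column(2) n[symmetric]] by simp
    have "R \<subseteq> {..<length (shape T)}" "R' \<subseteq> {..<length (shape T)}"
      using unrestricted_rows_less column.hyps(2) column(3) TT' by blast+
    then have "R = R'"
      using inj_on_image_eq_iff[OF inj_on_row_label[OF column.hyps(1)], of R R'] L TT' by simp
    then show ?thesis using TT' column(1) by simp
  qed
qed

text \<open>A fixed last point comes from an empty row. Otherwise \<open>ex_insertion\<close> yields
  \<open>L\<close>, which is the label set of some unrestricted rows because those labels are all
  the left-to-right maxima of the smaller permutation.\<close>

lemma \<Phi>_surj:
  "p permutes {1..n} \<Longrightarrow> \<exists>T. built T \<and> length (partition_path T) = n \<and> \<Phi> T = p"
proof (induction n arbitrary: p)
  case 0
  then have "p = id" by simp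
  moreover have "\<Phi> empty_tableau = id" using \<Phi>_outside[of _ empty_tableau] by (auto simp: fun_eq_iff)
  ultimately show ?case using built.empty by (intro exI[of _ empty_tableau]) simp
next
  case (Suc n)
  show ?case
  proof (cases "p (Suc n) = Suc n")
    case True
    then have "p permutes {1..n}"
      by (intro permutes_superset[OF Suc.prems]) (auto simp: le_Suc_eq)
    then obtain T where "built T" "length (partition_path T) = n" "\<Phi> T = p" using Suc.IH by blast
    then show ?thesis
      using built.row \<Phi>_add_row by (intro exI[of _ "add_row T"]) simp
  next
    case False
    then obtain p' L where p': "p' permutes {1..n}" "L \<subseteq> lr_maxima n p'" "L \<noteq> {}"
      "p = p' \<circ> insertion_cycle (Suc n) L"
      using ex_insertion[OF Suc.prems] by blast
    then obtain T where T: "built T" "length (partition_path T) = n" "\<Phi> T = p'" using Suc.IH by blast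
    then have "L \<subseteq> row_label T ` unrestricted_rows T" using p' \<Phi>_lr_maxima[OF T(1)] by simp
    then obtain R where R: "R \<subseteq> unrestricted_rows T" "L = row_label T ` R"
      by (meson subset_image_iff)
    then have "R \<noteq> {}" using p' by auto
    then show ?thesis
      using built.column[OF T(1) R(1)] \<Phi>_add_column_insertion(1)[OF T(1) R(1)] T R p'
      by (intro exI[of _ "add_column R T"]) simp
  qed
qed

theorem theorem11:
  fixes n :: nat
  assumes "n \<ge> 1"
  shows "(\<forall>k \<le> n. bij_betw \<Phi> (permutation_tableaux k (n - k))
            {p. p permutes {1..n} \<and> card (weak_excedances n p) = k}) \<and>
         bij_betw \<Phi> (\<Union>k \<in> {0..n}. permutation_tableaux k (n - k)) {p. p permutes {1..n}}"
proof -
  \<comment> \<open>The bijection is first obtained for all tableaux with \<open>n\<close> border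
    steps. The statement for fixed \<open>k\<close> restricts it to fibres, the number of rows on
    one side matching the number of weak excedances on the other.\<close>
  define \<T> where "\<T> = {T. built T \<and> length (partition_path T) = n}"
  have part: "permutation_tableaux k (n - k) = {T \<in> \<T>. length (shape T) = k}" if "k \<le> n" for k
    using that by (auto simp: in_permutation_tableaux_iff_built \<T>_def length_partition_path)
  have "length (shape T) \<le> n" if "T \<in> \<T>" for T
    using that by (auto simp: \<T>_def length_partition_path)
  then have union: "(\<Union>k \<in> {0..n}. permutation_tableaux k (n - k)) = \<T>"
    using part by auto
  have inj: "inj_on \<Phi> \<T>"
    using \<Phi>_inj by (auto simp: inj_on_def \<T>_def)
  have image: "\<Phi> ` \<T> = {p. p permutes {1..n}}"
    using \<Phi>_permutes \<Phi>_surj by (fastforce simp: \<T>_def)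
  have card: "card (weak_excedances n (\<Phi> T)) = length (shape T)" if "T \<in> \<T>" for T
    using that card_weak_excedances_\<Phi> by (auto simp: \<T>_def)
  have "\<Phi> ` {T \<in> \<T>. length (shape T) = k} = {p \<in> \<Phi> ` \<T>. card (weak_excedances n p) = k}" for k
    using card by auto
  then have "bij_betw \<Phi> (permutation_tableaux k (n - k))
      {p. p permutes {1..n} \<and> card (weak_excedances n p) = k}" if "k \<le> n" for k
    using part[OF that] image inj_on_subset[OF inj] by (auto simp: bij_betw_def)
  moreover have "bij_betw \<Phi> \<T> {p. p permutes {1..n}}"
    using inj image by (simp add: bij_betw_def)
  ultimately show ?thesis unfolding union by blast
qed

end
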